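(* Let $G$ and $G'$ each be both a groupoid and a topological space (no compatibility assumed) with Hausdorff unit space, and let $Y$ and $Y'$ be unital $1$-cancellative semigroups. Let $A\subseteq{}_Y\mathcal{O}(G)$ and $A'\subseteq{}_{Y'}\mathcal{O}(G')$ be semigroups whose products are given by $ab(gh)=a(g)b(h)$ whenever $\mathrm{dom}(a)$ or $\mathrm{dom}(b)$ is a bisection. Let $Z,D,S,N\subseteq A$ and $Z',D',S',N'\subseteq A'$ be the subsets defined in the context. If (1) $D$ and $D'$ are exhaustive, (2) $S=N$ is $Z$-bumpy and $S'=N'$ is $Z'$-bumpy, and (3) $A$ and $A'$ are diagonally isomorphic semigroups, then $G$ and $G'$ are isomorphic étale groupoids (i.e. there is a groupoid isomorphism $G\to G'$ that is a homeomorphism, and $G,G'$ are étale).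
   Context: For a groupoid $G$: $\mathsf{s}(g)=g^{-1}g$, $\mathsf{r}(g)=gg^{-1}$; $G^0$ is the set of units; $gh$ is defined iff $\mathsf{s}(g)=\mathsf{r}(h)$; for $X,X'\subseteq G$, $XX'=\{xx':x\in X,x'\in X',\mathsf{s}(x)=\mathsf{r}(x')\}$ and $X^{-1}=\{x^{-1}:x\in X\}$. $\mathcal{O}(G)$ is the topology of $G$; $\mathrm{int}$ denotes interior in $G$. A bisection is $B\subseteq G$ with $BB^{-1}\cup B^{-1}B\subseteq G^0$; $\mathcal{B}^\circ(G)$ is the set of open bisections. $G^{\mathrm{iso}}=\{g\in G:\mathsf{s}(g)=\mathsf{r}(g)\}$; an isosection is $I\subseteq G$ with $II^{-1}\cup I^{-1}I\subseteq G^{\mathrm{iso}}$. $G$ is étale if inversion and multiplication are continuous and $\mathsf{s}$ is a local homeomorphism onto an open subset of $G$. A unital semigroup $Y$ is $1$-cancellative if for all $x,y\in Y$: $xy=x\Leftrightarrow y=1\Leftrightarrow yx=x$. $Y^\times$ is its set of invertible elements and $\mathsf{Z}(Y)$ its centre. For a family $\mathcal{X}$ of subsets of $G$, ${}_Y\mathcal{X}$ is the set of partial functions $a$ from $G$ to $Y$ with domain $\mathrm{dom}(a)\in\mathcal{X}$; $\mathrm{ran}(a)$ is the range; for $W\subseteq Y$, $[W]a=\{g\in\mathrm{dom}(a):a(g)\in W\}$, $[1]a=[\{1\}]a$. The assumption on $A$: it is a set of partial functions with open domains carrying an associative product such that, whenever $\mathrm{dom}(a)$ or $\mathrm{dom}(b)$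 is a bisection, $ab$ is the function with domain $\mathrm{dom}(a)\mathrm{dom}(b)$ given by $ab(gh)=a(g)b(h)$ for $g\in\mathrm{dom}(a)$, $h\in\mathrm{dom}(b)$, $\mathsf{s}(g)=\mathsf{r}(h)$. (Nothing but associativity is assumed about other products.) Likewise for $A'$. Subsets of $A$ (and analogously primed subsets of $A'$): $Z=\{a\in A:\mathrm{dom}(a)\subseteq G^0,\ \mathrm{ran}(a)\subseteq\mathsf{Z}(Y)\}$; $D=\{a\in A:\mathrm{dom}(a)\subseteq G^0\}$; $S=\{a\in A:\mathrm{dom}(a)\text{ is a bisection}\}$; $N=\{a\in A:\mathrm{dom}(a)\text{ is an isosection}\}$. $D$ is exhaustive if for all $g\in G^0$ and $y\in Y$ there is $d\in D$ with $d(g)=y$. $A$ and $A'$ are diagonally isomorphic if there is a semigroup isomorphism $\phi:A\to A'$ with $\phi[D]=D'$. $S\subseteq{}_Y\mathcal{B}^\circ(G)$ is $Z$-bumpy if: (1-Proper) $[1]a$ is compact for all $a\in S$; (Urysohn) the empty function is in $S$, and whenever $g\in O\in\mathcal{O}(G)$ there is $a\in S$ with $\mathrm{dom}(a)\subseteq O$ and $g\in\mathrm{int}([Y^\times]a)$; ($Z$-Involutive) whenever $a\in S$ and $g\in\mathrm{int}([Y^\times]a)$, there is $b\in S$ such that $ab,ba\in Z$ and $g^{-1}\in\mathrm{int}(\{h\in G:a(h^{-1})=b(h)^{-1}\})$. *)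

theory Defs
  imports "HOL-Analysis.Analysis"
begin

section \<open>Groupoids\<close>

record 'g groupoid_struct =
  arrows :: "'g set"
  gmult  :: "'g \<Rightarrow> 'g \<Rightarrow> 'g"
  ginv   :: "'g \<Rightarrow> 'g"

definition gsrc :: "'g groupoid_struct \<Rightarrow> 'g \<Rightarrow> 'g"
  where "gsrc G g = gmult G (ginv G g) g"

definition grng :: "'g groupoid_struct \<Rightarrow> 'g \<Rightarrow> 'g"
  where "grng G g = gmult G g (ginv G g)"

text \<open>
  The function \<^term>\<open>gmult G\<close> is total, but only its values on composable pairs
  (\<^term>\<open>gsrc G g = grng G h\<close>) are meaningful; these axioms say that the partial
  multiplication so obtained makes the (possibly empty) set of arrows a groupoid.
\<close>

locale groupoid =
  fixes G :: "'g groupoid_struct"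
  assumes inv_closed: "g \<in> arrows G \<Longrightarrow> ginv G g \<in> arrows G"
    and inv_inv: "g \<in> arrows G \<Longrightarrow> ginv G (ginv G g) = g"
    and mult_closed:
      "\<lbrakk>g \<in> arrows G; h \<in> arrows G; gsrc G g = grng G h\<rbrakk> \<Longrightarrow> gmult G g h \<in> arrows G"
    and src_mult:
      "\<lbrakk>g \<in> arrows G; h \<in> arrows G; gsrc G g = grng G h\<rbrakk> \<Longrightarrow> gsrc G (gmult G g h) = gsrc G h"
    and rng_mult:
      "\<lbrakk>g \<in> arrows G; h \<in> arrows G; gsrc G g = grng G h\<rbrakk> \<Longrightarrow> grng G (gmult G g h) = grng G g"
    and assoc:
      "\<lbrakk>g \<in> arrows G; h \<in> arrows G; k \<in> arrows G; gsrc G g = grng G h; gsrc G h = grng G k\<rbrakk>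
        \<Longrightarrow> gmult G (gmult G g h) k = gmult G g (gmult G h k)"
    and inv_mult_cancel:
      "\<lbrakk>g \<in> arrows G; h \<in> arrows G; gsrc G g = grng G h\<rbrakk>
        \<Longrightarrow> gmult G (ginv G g) (gmult G g h) = h"
    and mult_inv_cancel:
      "\<lbrakk>g \<in> arrows G; h \<in> arrows G; gsrc G g = grng G h\<rbrakk>
        \<Longrightarrow> gmult G (gmult G g h) (ginv G h) = g"

definition gunits :: "'g groupoid_struct \<Rightarrow> 'g set"
  where "gunits G = gsrc G ` arrows G"

definition giso :: "'g groupoid_struct \<Rightarrow> 'g set"
  where "giso G = {g \<in> arrows G. gsrc G g = grng G g}"

definition composable_pairs :: "'g groupoid_struct \<Rightarrow> ('g \<times> 'g) set"
  where "composable_pairs G = {(g, h). g \<in> arrows G \<and> h \<in> arrows G \<and> gsrc G g = grng G h}"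

definition set_gmult :: "'g groupoid_struct \<Rightarrow> 'g set \<Rightarrow> 'g set \<Rightarrow> 'g set"
  where "set_gmult G X X' = {gmult G x x' | x x'. x \<in> X \<and> x' \<in> X' \<and> gsrc G x = grng G x'}"

definition bisection :: "'g groupoid_struct \<Rightarrow> 'g set \<Rightarrow> bool"
  where "bisection G B \<longleftrightarrow> B \<subseteq> arrows G \<and>
    set_gmult G B (ginv G ` B) \<union> set_gmult G (ginv G ` B) B \<subseteq> gunits G"

definition isosection :: "'g groupoid_struct \<Rightarrow> 'g set \<Rightarrow> bool"
  where "isosection G I \<longleftrightarrow> I \<subseteq> arrows G \<and>
    set_gmult G I (ginv G ` I) \<union> set_gmult G (ginv G ` I) I \<subseteq> giso G"

definition local_homeomorphism :: "'a topology \<Rightarrow> 'b topology \<Rightarrow> ('a \<Rightarrow> 'b) \<Rightarrow> bool"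
  where "local_homeomorphism X Y f \<longleftrightarrow>
    (\<forall>x \<in> topspace X. \<exists>U. openin X U \<and> x \<in> U \<and> openin Y (f ` U) \<and>
       homeomorphic_map (subtopology X U) (subtopology Y (f ` U)) f)"

definition etale :: "'g groupoid_struct \<Rightarrow> 'g topology \<Rightarrow> bool"
  where "etale G T \<longleftrightarrow>
    continuous_map T T (ginv G) \<and>
    continuous_map (subtopology (prod_topology T T) (composable_pairs G)) T
      (\<lambda>(g, h). gmult G g h) \<and>
    openin T (gsrc G ` arrows G) \<and>
    local_homeomorphism T (subtopology T (gsrc G ` arrows G)) (gsrc G)"

definition groupoid_isomorphism ::
    "'g groupoid_struct \<Rightarrow> 'h groupoid_struct \<Rightarrow> ('g \<Rightarrow> 'h) \<Rightarrow> bool"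
  where "groupoid_isomorphism G H \<psi> \<longleftrightarrow>
    bij_betw \<psi> (arrows G) (arrows H) \<and>
    (\<forall>g \<in> arrows G. \<forall>h \<in> arrows G.
       (gsrc G g = grng G h \<longleftrightarrow> gsrc H (\<psi> g) = grng H (\<psi> h)) \<and>
       (gsrc G g = grng G h \<longrightarrow> \<psi> (gmult G g h) = gmult H (\<psi> g) (\<psi> h)))"

section \<open>Unital semigroups\<close>

class one_cancellative = monoid_mult +
  assumes mult_eq_left_iff: "x * y = x \<longleftrightarrow> y = 1"
    and mult_eq_right_iff: "y * x = x \<longleftrightarrow> y = 1"

definition is_inverse :: "'y::monoid_mult \<Rightarrow> 'y \<Rightarrow> bool"
  where "is_inverse x y \<longleftrightarrow> x * y = 1 \<and> y * x = 1"

definition invertibles :: "'y::monoid_mult set"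
  where "invertibles = {x. \<exists>y. is_inverse x y}"

definition centre :: "'y::monoid_mult set"
  where "centre = {x. \<forall>y. x * y = y * x}"

section \<open>Semigroups of partial functions on a groupoid\<close>

definition pfuns :: "'g set set \<Rightarrow> ('g \<rightharpoonup> 'y) set"
  where "pfuns X = {a. dom a \<in> X}"

definition level :: "'y set \<Rightarrow> ('g \<rightharpoonup> 'y) \<Rightarrow> 'g set"
  where "level W a = {g \<in> dom a. the (a g) \<in> W}"

text \<open>
  The operation \<^term>\<open>m\<close> is an arbitrary associative operation on \<^term>\<open>A\<close>, which is
  prescribed only on those pairs one of whose members is supported on a bisection.
\<close>

definition pfun_semigroup ::
    "'g groupoid_struct \<Rightarrow> 'g topology \<Rightarrow> ('g \<rightharpoonup> 'y::monoid_mult) set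
      \<Rightarrow> (('g \<rightharpoonup> 'y) \<Rightarrow> ('g \<rightharpoonup> 'y) \<Rightarrow> ('g \<rightharpoonup> 'y)) \<Rightarrow> bool"
  where "pfun_semigroup G T A m \<longleftrightarrow>
    A \<subseteq> pfuns {U. openin T U} \<and>
    (\<forall>a \<in> A. \<forall>b \<in> A. m a b \<in> A) \<and>
    (\<forall>a \<in> A. \<forall>b \<in> A. \<forall>c \<in> A. m (m a b) c = m a (m b c)) \<and>
    (\<forall>a \<in> A. \<forall>b \<in> A. bisection G (dom a) \<or> bisection G (dom b) \<longrightarrow>
       dom (m a b) = set_gmult G (dom a) (dom b) \<and>
       (\<forall>g \<in> dom a. \<forall>h \<in> dom b. gsrc G g = grng G h \<longrightarrow>
          the (m a b (gmult G g h)) = the (a g) * the (b h)))"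

definition Z_part :: "'g groupoid_struct \<Rightarrow> ('g \<rightharpoonup> 'y::monoid_mult) set \<Rightarrow> ('g \<rightharpoonup> 'y) set"
  where "Z_part G A = {a \<in> A. dom a \<subseteq> gunits G \<and> ran a \<subseteq> centre}"

definition D_part :: "'g groupoid_struct \<Rightarrow> ('g \<rightharpoonup> 'y) set \<Rightarrow> ('g \<rightharpoonup> 'y) set"
  where "D_part G A = {a \<in> A. dom a \<subseteq> gunits G}"

definition S_part :: "'g groupoid_struct \<Rightarrow> ('g \<rightharpoonup> 'y) set \<Rightarrow> ('g \<rightharpoonup> 'y) set"
  where "S_part G A = {a \<in> A. bisection G (dom a)}"

definition N_part :: "'g groupoid_struct \<Rightarrow> ('g \<rightharpoonup> 'y) set \<Rightarrow> ('g \<rightharpoonup> 'y) set"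
  where "N_part G A = {a \<in> A. isosection G (dom a)}"

definition exhaustive :: "'g groupoid_struct \<Rightarrow> ('g \<rightharpoonup> 'y) set \<Rightarrow> bool"
  where "exhaustive G D \<longleftrightarrow> (\<forall>g \<in> gunits G. \<forall>y. \<exists>d \<in> D. d g = Some y)"

definition one_proper :: "'g topology \<Rightarrow> ('g \<rightharpoonup> 'y::monoid_mult) set \<Rightarrow> bool"
  where "one_proper T S \<longleftrightarrow> (\<forall>a \<in> S. compactin T (level {1} a))"

definition urysohn :: "'g topology \<Rightarrow> ('g \<rightharpoonup> 'y::monoid_mult) set \<Rightarrow> bool"
  where "urysohn T S \<longleftrightarrow> Map.empty \<in> S \<and>
    (\<forall>U g. openin T U \<and> g \<in> U \<longrightarrow>
       (\<exists>a \<in> S. dom a \<subseteq> U \<and> g \<in> T interior_of (level invertibles a)))"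

text \<open>
  The equation \<open>a(h\<inverse>) = b(h)\<inverse>\<close> includes the requirement that both sides are defined,
  i.e. that \<open>h\<inverse>\<close> is in the domain of \<open>a\<close>, \<open>h\<close> is in the domain of \<open>b\<close> and
  \<open>b(h)\<close> is invertible.
\<close>

definition Z_involutive ::
    "'g groupoid_struct \<Rightarrow> 'g topology \<Rightarrow> (('g \<rightharpoonup> 'y::monoid_mult) \<Rightarrow> ('g \<rightharpoonup> 'y) \<Rightarrow> ('g \<rightharpoonup> 'y))
      \<Rightarrow> ('g \<rightharpoonup> 'y) set \<Rightarrow> ('g \<rightharpoonup> 'y) set \<Rightarrow> bool"
  where "Z_involutive G T m Z S \<longleftrightarrow>
    (\<forall>a \<in> S. \<forall>g \<in> T interior_of (level invertibles a).
       \<exists>b \<in> S. m a b \<in> Z \<and> m b a \<in> Z \<and>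
         ginv G g \<in> T interior_of
           {h \<in> arrows G. ginv G h \<in> dom a \<and> h \<in> dom b \<and>
                          is_inverse (the (b h)) (the (a (ginv G h)))})"

definition Z_bumpy ::
    "'g groupoid_struct \<Rightarrow> 'g topology \<Rightarrow> (('g \<rightharpoonup> 'y::monoid_mult) \<Rightarrow> ('g \<rightharpoonup> 'y) \<Rightarrow> ('g \<rightharpoonup> 'y))
      \<Rightarrow> ('g \<rightharpoonup> 'y) set \<Rightarrow> ('g \<rightharpoonup> 'y) set \<Rightarrow> bool"
  where "Z_bumpy G T m Z S \<longleftrightarrow>
    S \<subseteq> pfuns {B. openin T B \<and> bisection G B} \<and>
    one_proper T S \<and> urysohn T S \<and> Z_involutive G T m Z S"

definition diagonally_isomorphic ::
    "'g groupoid_struct \<Rightarrow> ('g \<rightharpoonup> 'y) set \<Rightarrow> (('g \<rightharpoonup> 'y) \<Rightarrow> ('g \<rightharpoonup> 'y) \<Rightarrow> ('g \<rightharpoonup> 'y))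
      \<Rightarrow> 'h groupoid_struct \<Rightarrow> ('h \<rightharpoonup> 'z) set \<Rightarrow> (('h \<rightharpoonup> 'z) \<Rightarrow> ('h \<rightharpoonup> 'z) \<Rightarrow> ('h \<rightharpoonup> 'z))
      \<Rightarrow> bool"
  where "diagonally_isomorphic G A m G' A' m' \<longleftrightarrow>
    (\<exists>\<phi>. bij_betw \<phi> A A' \<and> (\<forall>a \<in> A. \<forall>b \<in> A. \<phi> (m a b) = m' (\<phi> a) (\<phi> b)) \<and>
         \<phi> ` D_part G A = D_part G' A')"

end

theory Submission
  imports Defs
begin

text \<open>
  Both the topology and the algebra of \<open>G\<close> can be read off from the elements of \<open>S\<close>: their
  domains form a basis of open bisections. Since elements of the semigroup have open domains,
  products of open sets are open, and the local inverses provided by involutivity make inversion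
  continuous, so the topology is automatically etale (\<open>etale\<close>).

  An arbitrary element \<open>a\<close> can be multiplied in a known way only with elements supported on
  bisections, for instance with elements of \<open>D\<close>. This suffices to recognise whether \<open>dom a\<close> is an
  isosection: the arrows in \<open>dom a\<close> with range in \<open>dom d\<close> and source in \<open>dom e\<close> exist iff \<open>d a e\<close>
  is not the empty function, and as source and range are open continuous maps into a Hausdorff space,
  the failure of one to determine the other is visible on basic open sets
  (\<open>fibre_not_constant_iff\<close>, \<open>N_part_eq\<close>). The empty function is the zero of the
  semigroup, so a diagonal isomorphism preserves it and therefore maps \<open>N = S\<close> onto \<open>N' = S'\<close>.

  It remains to recover \<open>G\<close> from the pair \<open>D \<subseteq> S\<close>. Call \<open>a\<close> dominated by \<open>b\<close> if some \<open>s \<in> S\<close>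
  satisfies \<open>sb, as \<in> D\<close> and \<open>a(sb) = a\<close>. By 1-cancellativity \<open>sb\<close> takes the value \<open>1\<close> at the
  sources of \<open>dom a\<close>, so that \<open>b\<close> is invertible on \<open>dom a\<close>, and the compact set \<open>[1](sb)\<close> fits
  between the sources of \<open>dom a\<close> and those of \<open>dom b\<close> (\<open>dominatedD\<close>). Conversely \<open>b\<close> dominates
  everything supported close to a point around which \<open>b\<close> is invertible
  (\<open>dominated_locally\<close>). Hence the elements of \<open>S\<close> that are invertible around an arrow
  \<open>g\<close> form a filter for domination, every such filter is contained in one of this form
  by compactness (\<open>filter_subset_bumps_at\<close>), and inclusions between filters of points are
  equalities (\<open>bumps_at_subset_eq\<close>). So the isomorphism, which preserves domination, induces a
  bijection between arrows (\<open>bumps_at_image\<close>). The multiplication and the topology are determined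
  by the filters of points (\<open>bumps_at_mult_iff\<close>, \<open>openin_iff_bumps\<close>), whence the bijection is
  an isomorphism of groupoids and a homeomorphism.
\<close>

section \<open>Groupoids\<close>

lemma set_gmultI:
  "x \<in> X \<Longrightarrow> y \<in> Y \<Longrightarrow> gsrc G x = grng G y \<Longrightarrow> gmult G x y \<in> set_gmult G X Y"
  by (auto simp: set_gmult_def)

context groupoid
begin

lemma src_inv: "g \<in> arrows G \<Longrightarrow> gsrc G (ginv G g) = grng G g"
  by (simp add: gsrc_def grng_def inv_inv)

lemma rng_inv: "g \<in> arrows G \<Longrightarrow> grng G (ginv G g) = gsrc G g"
  by (simp add: gsrc_def grng_def inv_inv)

lemma src_closed: "g \<in> arrows G \<Longrightarrow> gsrc G g \<in> arrows G"
  by (metis gsrc_def inv_closed mult_closed src_inv)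

lemma rng_closed: "g \<in> arrows G \<Longrightarrow> grng G g \<in> arrows G"
  by (metis src_closed src_inv inv_closed)

lemma src_src: "g \<in> arrows G \<Longrightarrow> gsrc G (gsrc G g) = gsrc G g"
  by (metis gsrc_def inv_closed src_mult src_inv)

lemma rng_src: "g \<in> arrows G \<Longrightarrow> grng G (gsrc G g) = gsrc G g"
  by (metis gsrc_def inv_closed rng_mult src_inv rng_inv)

lemma src_in_units: "g \<in> arrows G \<Longrightarrow> gsrc G g \<in> gunits G"
  by (simp add: gunits_def)

lemma rng_in_units: "g \<in> arrows G \<Longrightarrow> grng G g \<in> gunits G"
  by (metis src_in_units src_inv inv_closed)

lemma units_sub: "gunits G \<subseteq> arrows G"
  by (auto simp: gunits_def src_closed)

lemma src_unit: "u \<in> gunits G \<Longrightarrow> gsrc G u = u"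
  by (auto simp: gunits_def src_src)

lemma rng_unit: "u \<in> gunits G \<Longrightarrow> grng G u = u"
  by (auto simp: gunits_def rng_src)

lemma mult_src: "g \<in> arrows G \<Longrightarrow> gmult G g (gsrc G g) = g"
  by (metis gsrc_def inv_closed inv_mult_cancel inv_inv src_inv)

lemma rng_mult_id: "g \<in> arrows G \<Longrightarrow> gmult G (grng G g) g = g"
  by (metis grng_def inv_closed mult_inv_cancel inv_inv rng_inv)

text \<open>A unit equals its own source, so \<open>gh\<close> can be a unit only if it is \<open>s(h) = h\<inverse>h\<close>, and then
  \<open>h\<close> cancels.\<close>

lemma mult_unitD:
  assumes "g \<in> arrows G" "h \<in> arrows G" "gsrc G g = grng G h" "gmult G g h \<in> gunits G"
  shows "g = ginv G h"
proof -
  have "gmult G g h = gsrc G h"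
    using assms by (metis src_unit src_mult)
  then show ?thesis
    using assms by (metis gsrc_def mult_inv_cancel inv_closed src_inv rng_inv mult_src)
qed

lemma mult_inv_unitD:
  assumes "g \<in> arrows G" "h \<in> arrows G" "gsrc G g = gsrc G h" "gmult G g (ginv G h) \<in> gunits G"
  shows "g = h"
  using mult_unitD[of g "ginv G h"] assms by (simp add: inv_closed inv_inv rng_inv)

lemma inv_mult_unitD:
  assumes "g \<in> arrows G" "h \<in> arrows G" "grng G g = grng G h" "gmult G (ginv G g) h \<in> gunits G"
  shows "g = h"
  using mult_unitD[of "ginv G g" h] assms by (metis inv_closed inv_inv src_inv)

lemma bisection_iff:
  "bisection G B \<longleftrightarrow> B \<subseteq> arrows G \<and> inj_on (gsrc G) B \<and> inj_on (grng G) B"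
proof
  assume "bisection G B"
  then have B: "B \<subseteq> arrows G" "set_gmult G B (ginv G ` B) \<subseteq> gunits G"
    "set_gmult G (ginv G ` B) B \<subseteq> gunits G"
    by (auto simp: bisection_def)
  have "g = h" if "g \<in> B" "h \<in> B" "gsrc G g = gsrc G h" for g h
  proof (rule mult_inv_unitD)
    have "gmult G g (ginv G h) \<in> set_gmult G B (ginv G ` B)"
      using that B(1) by (intro set_gmultI) (auto simp: rng_inv subset_iff)
    then show "gmult G g (ginv G h) \<in> gunits G" using B by blast
  qed (use that B in auto)
  moreover have "g = h" if "g \<in> B" "h \<in> B" "grng G g = grng G h" for g h
  proof (rule inv_mult_unitD)
    have "gmult G (ginv G g) h \<in> set_gmult G (ginv G ` B) B"
      using that B(1) by (intro set_gmultI) (auto simp: src_inv subset_iff)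
    then show "gmult G (ginv G g) h \<in> gunits G" using B by blast
  qed (use that B in auto)
  ultimately show "B \<subseteq> arrows G \<and> inj_on (gsrc G) B \<and> inj_on (grng G) B"
    using B by (auto simp: inj_on_def)
next
  assume B: "B \<subseteq> arrows G \<and> inj_on (gsrc G) B \<and> inj_on (grng G) B"
  have "gmult G g (ginv G h) \<in> gunits G"
    if "g \<in> B" "h \<in> B" "gsrc G g = grng G (ginv G h)" for g h
  proof -
    have "g = h" using that B by (auto simp: inj_on_def rng_inv subset_iff)
    then show ?thesis using that B by (metis grng_def rng_in_units subsetD)
  qed
  moreover have "gmult G (ginv G g) h \<in> gunits G"
    if "g \<in> B" "h \<in> B" "gsrc G (ginv G g) = grng G h" for g h
  proof -
    have "g = h" using that B by (auto simp: inj_on_def src_inv subset_iff)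
    then show ?thesis using that B by (metis gsrc_def src_in_units subsetD)
  qed
  ultimately show "bisection G B" using B by (auto simp: bisection_def set_gmult_def)
qed

lemma isosection_iff:
  "isosection G B \<longleftrightarrow>
    B \<subseteq> arrows G \<and> (\<forall>g\<in>B. \<forall>h\<in>B. gsrc G g = gsrc G h \<longleftrightarrow> grng G g = grng G h)"
proof -
  have *: "gmult G g (ginv G h) \<in> giso G \<longleftrightarrow> grng G g = grng G h"
    if "g \<in> arrows G" "h \<in> arrows G" "gsrc G g = gsrc G h" for g h
    using that
    by (auto simp: giso_def mult_closed inv_closed src_mult rng_mult src_inv rng_inv)
  have **: "gmult G (ginv G g) h \<in> giso G \<longleftrightarrow> gsrc G g = gsrc G h"
    if "g \<in> arrows G" "h \<in> arrows G" "grng G g = grng G h" for g h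
    using that
    by (auto simp: giso_def mult_closed inv_closed src_mult rng_mult src_inv rng_inv)
  show ?thesis
  proof (cases "B \<subseteq> arrows G")
    case True
    have "set_gmult G B (ginv G ` B) \<subseteq> giso G \<longleftrightarrow>
        (\<forall>g\<in>B. \<forall>h\<in>B. gsrc G g = gsrc G h \<longrightarrow> gmult G g (ginv G h) \<in> giso G)"
      using True unfolding set_gmult_def by (fastforce simp: rng_inv subset_iff)
    also have "\<dots> \<longleftrightarrow> (\<forall>g\<in>B. \<forall>h\<in>B. gsrc G g = gsrc G h \<longrightarrow> grng G g = grng G h)"
      by (intro ball_cong refl imp_cong *) (use True in auto)
    finally have 1: "set_gmult G B (ginv G ` B) \<subseteq> giso G \<longleftrightarrow> \<dots>" .
    have "set_gmult G (ginv G ` B) B \<subseteq> giso G \<longleftrightarrow>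
        (\<forall>g\<in>B. \<forall>h\<in>B. grng G g = grng G h \<longrightarrow> gmult G (ginv G g) h \<in> giso G)"
      using True unfolding set_gmult_def by (fastforce simp: src_inv subset_iff)
    also have "\<dots> \<longleftrightarrow> (\<forall>g\<in>B. \<forall>h\<in>B. grng G g = grng G h \<longrightarrow> gsrc G g = gsrc G h)"
      by (intro ball_cong refl imp_cong **) (use True in auto)
    finally have 2: "set_gmult G (ginv G ` B) B \<subseteq> giso G \<longleftrightarrow> \<dots>" .
    show ?thesis
      unfolding isosection_def Un_subset_iff 1 2 using True by blast
  qed (simp add: isosection_def)
qed

lemma bisection_mult:
  assumes "bisection G B" "bisection G C"
  shows "bisection G (set_gmult G B C)"
proof -
  have BC: "B \<subseteq> arrows G" "C \<subseteq> arrows G" "inj_on (gsrc G) B" "inj_on (gsrc G) C"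
    "inj_on (grng G) B" "inj_on (grng G) C"
    using assms by (auto simp: bisection_iff)
  have 1: "gmult G g h = gmult G g' h'"
    if "g \<in> B" "h \<in> C" "g' \<in> B" "h' \<in> C" "gsrc G g = grng G h" "gsrc G g' = grng G h'"
      "gsrc G (gmult G g h) = gsrc G (gmult G g' h')" for g h g' h'
  proof -
    have "g \<in> arrows G" "h \<in> arrows G" "g' \<in> arrows G" "h' \<in> arrows G"
      using that BC by auto
    then have "gsrc G h = gsrc G h'" using that src_mult[of g h] src_mult[of g' h'] by simp
    then have "h = h'" using that BC by (auto dest: inj_onD)
    moreover from this have "g = g'" using that BC inj_on_eq_iff[of "gsrc G" B g g'] by simp
    ultimately show ?thesis by simp
  qed
  have 2: "gmult G g h = gmult G g' h'"
    if "g \<in> B" "h \<in> C" "g' \<in> B" "h' \<in> C" "gsrc G g = grng G h" "gsrc G g' = grng G h'"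
      "grng G (gmult G g h) = grng G (gmult G g' h')" for g h g' h'
  proof -
    have "g \<in> arrows G" "h \<in> arrows G" "g' \<in> arrows G" "h' \<in> arrows G"
      using that BC by auto
    then have "grng G g = grng G g'" using that rng_mult[of g h] rng_mult[of g' h'] by simp
    then have "g = g'" using that BC by (auto dest: inj_onD)
    moreover from this have "h = h'" using that BC inj_on_eq_iff[of "grng G" C h h'] by simp
    ultimately show ?thesis by simp
  qed
  have "set_gmult G B C \<subseteq> arrows G"
    using BC by (auto simp: set_gmult_def subset_iff intro: mult_closed)
  moreover have "inj_on (gsrc G) (set_gmult G B C)"
    using 1 by (fastforce simp: inj_on_def set_gmult_def)
  moreover have "inj_on (grng G) (set_gmult G B C)"
    using 2 by (fastforce simp: inj_on_def set_gmult_def)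
  ultimately show ?thesis by (simp add: bisection_iff)
qed

lemma bisection_units: "V \<subseteq> gunits G \<Longrightarrow> bisection G V"
  using units_sub by (auto simp: bisection_iff inj_on_def src_unit rng_unit subset_iff)

lemma set_gmult_units_right:
  assumes "X \<subseteq> arrows G" "V \<subseteq> gunits G"
  shows "set_gmult G X V = {g \<in> X. gsrc G g \<in> V}"
proof -
  have "gmult G x v \<in> X \<and> gsrc G (gmult G x v) \<in> V" if "x \<in> X" "v \<in> V" "gsrc G x = grng G v" for x v
  proof -
    have "v = gsrc G x" using that rng_unit[of v] assms by auto
    then show ?thesis using that mult_src[of x] assms by auto
  qed
  moreover have "\<exists>x v. g = gmult G x v \<and> x \<in> X \<and> v \<in> V \<and> gsrc G x = grng G v"
    if "g \<in> X" "gsrc G g \<in> V" for g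
  proof (intro exI conjI)
    show "g = gmult G g (gsrc G g)" using that mult_src[of g] assms by auto
  qed (use that rng_unit[of "gsrc G g"] assms in auto)
  ultimately show ?thesis by (auto simp: set_gmult_def)
qed

lemma set_gmult_units_left:
  assumes "X \<subseteq> arrows G" "V \<subseteq> gunits G"
  shows "set_gmult G V X = {g \<in> X. grng G g \<in> V}"
proof -
  have "gmult G v x \<in> X \<and> grng G (gmult G v x) \<in> V" if "x \<in> X" "v \<in> V" "gsrc G v = grng G x" for x v
  proof -
    have "v = grng G x" using that src_unit[of v] assms by auto
    then show ?thesis using that rng_mult_id[of x] assms by auto
  qed
  moreover have "\<exists>v x. g = gmult G v x \<and> v \<in> V \<and> x \<in> X \<and> gsrc G v = grng G x"
    if "g \<in> X" "grng G g \<in> V" for g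
  proof (intro exI conjI)
    show "g = gmult G (grng G g) g" using that rng_mult_id[of g] assms by auto
  qed (use that src_unit[of "grng G g"] assms in auto)
  ultimately show ?thesis by (auto simp: set_gmult_def)
qed

text \<open>The sources of an arbitrary set \<open>X\<close> of arrows are the units among the products
  \<open>g x\<close> with \<open>x \<in> X\<close>, because such a product is a unit only for \<open>g = x\<inverse>\<close>. Hence the source
  map is open as soon as products of open sets are open and the units form an open set.\<close>

lemma src_image_eq:
  assumes "X \<subseteq> arrows G"
  shows "gsrc G ` X = set_gmult G (arrows G) X \<inter> gunits G"
proof -
  have "gmult G g x \<in> gsrc G ` X"
    if "g \<in> arrows G" "x \<in> X" "gsrc G g = grng G x" "gmult G g x \<in> gunits G" for g x
  proof -
    have "gmult G g x = gsrc G x" using src_unit[OF that(4)] src_mult[of g x] that assms by auto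
    then show ?thesis using that by simp
  qed
  moreover have "gsrc G x \<in> set_gmult G (arrows G) X" if "x \<in> X" for x
    unfolding gsrc_def[of G x] using that assms
    by (intro set_gmultI) (auto simp: inv_closed src_inv subset_iff)
  ultimately show ?thesis using assms src_in_units by (auto simp: set_gmult_def)
qed

lemma rng_image_eq:
  assumes "X \<subseteq> arrows G"
  shows "grng G ` X = set_gmult G X (arrows G) \<inter> gunits G"
proof -
  have "gmult G x g \<in> grng G ` X"
    if "g \<in> arrows G" "x \<in> X" "gsrc G x = grng G g" "gmult G x g \<in> gunits G" for g x
  proof -
    have "gmult G x g = grng G x" using rng_unit[OF that(4)] rng_mult[of x g] that assms by auto
    then show ?thesis using that by simp
  qed
  moreover have "grng G x \<in> set_gmult G X (arrows G)" if "x \<in> X" for x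
    unfolding grng_def[of G x] using that assms
    by (intro set_gmultI) (auto simp: inv_closed rng_inv subset_iff)
  ultimately show ?thesis using assms rng_in_units by (auto simp: set_gmult_def)
qed

end

section \<open>The topology defined by a bumpy semigroup is etale\<close>

locale bumpy_semigroup = groupoid G for G :: "'g groupoid_struct" +
  fixes T :: "'g topology"
    and A :: "('g \<rightharpoonup> 'y::one_cancellative) set"
    and m :: "('g \<rightharpoonup> 'y) \<Rightarrow> ('g \<rightharpoonup> 'y) \<Rightarrow> ('g \<rightharpoonup> 'y)"
  assumes topspace_T: "topspace T = arrows G"
    and Hausdorff_units: "Hausdorff_space (subtopology T (gunits G))"
    and pfun_semigroup: "pfun_semigroup G T A m"
    and bumpy: "Z_bumpy G T m (Z_part G A) (S_part G A)"
begin

abbreviation D where "D \<equiv> D_part G A"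
abbreviation S where "S \<equiv> S_part G A"

lemma S_sub_A: "S \<subseteq> A"
  by (auto simp: S_part_def)

lemma D_sub_S: "D \<subseteq> S"
  by (auto simp: S_part_def D_part_def bisection_units)

lemma D_dom: "d \<in> D \<Longrightarrow> dom d \<subseteq> gunits G"
  by (auto simp: D_part_def)

lemma DI: "a \<in> A \<Longrightarrow> dom a \<subseteq> gunits G \<Longrightarrow> a \<in> D"
  by (auto simp: D_part_def)

lemma open_dom: "a \<in> A \<Longrightarrow> openin T (dom a)"
  using pfun_semigroup by (auto simp: pfun_semigroup_def pfuns_def)

lemma dom_arrows: "a \<in> A \<Longrightarrow> dom a \<subseteq> arrows G"
  using open_dom openin_subset topspace_T by metis

lemma mult_A: "a \<in> A \<Longrightarrow> b \<in> A \<Longrightarrow> m a b \<in> A"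
  using pfun_semigroup by (simp add: pfun_semigroup_def)

lemma dom_mult:
  assumes "a \<in> A" "b \<in> A" "a \<in> S \<or> b \<in> S"
  shows "dom (m a b) = set_gmult G (dom a) (dom b)"
  using pfun_semigroup assms unfolding pfun_semigroup_def S_part_def by blast

lemma value_mult:
  assumes "a \<in> A" "b \<in> A" "a \<in> S \<or> b \<in> S" "g \<in> dom a" "h \<in> dom b" "gsrc G g = grng G h"
  shows "the (m a b (gmult G g h)) = the (a g) * the (b h)"
  using pfun_semigroup assms unfolding pfun_semigroup_def S_part_def by blast

lemma S_mult: "a \<in> S \<Longrightarrow> b \<in> S \<Longrightarrow> m a b \<in> S"
  using dom_mult[of a b] mult_A[of a b] by (simp add: S_part_def bisection_mult)

lemma dom_mult_D_right: "a \<in> A \<Longrightarrow> d \<in> D \<Longrightarrow> dom (m a d) = {g \<in> dom a. gsrc G g \<in> dom d}"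
  using dom_mult[of a d] D_sub_S S_sub_A dom_arrows D_dom
  by (simp add: set_gmult_units_right subset_iff)

lemma dom_mult_D_left: "a \<in> A \<Longrightarrow> d \<in> D \<Longrightarrow> dom (m d a) = {g \<in> dom a. grng G g \<in> dom d}"
  using dom_mult[of d a] D_sub_S S_sub_A dom_arrows D_dom
  by (simp add: set_gmult_units_left subset_iff)

lemma dom_mult_D_D:
  assumes "d \<in> D" "e \<in> D"
  shows "dom (m d e) = dom d \<inter> dom e"
proof -
  have "d \<in> A" using assms D_sub_S S_sub_A by blast
  then show ?thesis
    using dom_mult_D_right[of d e] src_unit D_dom[OF assms(1)] assms(2) by auto
qed

lemma D_mult: "d \<in> D \<Longrightarrow> e \<in> D \<Longrightarrow> m d e \<in> D"
  using dom_mult_D_D[of d e] mult_A[of d e] by (auto simp: D_part_def)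

lemma value_mult_D_right:
  assumes "a \<in> A" "d \<in> D" "g \<in> dom a" "gsrc G g \<in> dom d"
  shows "the (m a d g) = the (a g) * the (d (gsrc G g))"
proof -
  have "g \<in> arrows G" "d \<in> S" "d \<in> A" using assms dom_arrows D_sub_S S_sub_A by auto
  then show ?thesis
    using value_mult[of a d g "gsrc G g"] assms by (simp add: mult_src rng_src)
qed

lemma empty_S: "Map.empty \<in> S"
  using bumpy by (simp add: Z_bumpy_def urysohn_def)

lemma empty_D: "Map.empty \<in> D"
  using empty_S by (auto simp: S_part_def D_part_def)

lemma mult_empty:
  assumes "a \<in> A"
  shows "m Map.empty a = Map.empty" "m a Map.empty = Map.empty"
proof -
  have "dom (m Map.empty a) = {}" "dom (m a Map.empty) = {}"
    using dom_mult_D_left[OF assms empty_D] dom_mult_D_right[OF assms empty_D] by auto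
  then show "m Map.empty a = Map.empty" "m a Map.empty = Map.empty" by auto
qed

text \<open>The filter that stands for the arrow \<open>g\<close> in the reconstruction of the groupoid.\<close>

definition bumps_at :: "'g \<Rightarrow> ('g \<rightharpoonup> 'y) set"
  where "bumps_at g = {a \<in> S. g \<in> T interior_of level invertibles a}"

lemma bumps_at_S: "a \<in> bumps_at g \<Longrightarrow> a \<in> S"
  by (simp add: bumps_at_def)

lemma bumps_at_dom: "a \<in> bumps_at g \<Longrightarrow> g \<in> dom a"
  using interior_of_subset[of T "level invertibles a"] by (auto simp: bumps_at_def level_def)

lemma open_bumps: "openin T {g \<in> arrows G. a \<in> bumps_at g}"
proof -
  have "{g \<in> arrows G. a \<in> bumps_at g} = (if a \<in> S then T interior_of level invertibles a else {})"
    using openin_subset[OF openin_interior_of, of T "level invertibles a"]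
    by (auto simp: bumps_at_def topspace_T)
  then show ?thesis by simp
qed

lemma bump:
  assumes "openin T U" "g \<in> U"
  obtains a where "a \<in> bumps_at g" "dom a \<subseteq> U"
  using bumpy assms unfolding Z_bumpy_def urysohn_def bumps_at_def by blast

lemma basic:
  assumes "openin T U" "g \<in> U"
  obtains a where "a \<in> S" "g \<in> dom a" "dom a \<subseteq> U"
  using bump[OF assms] bumps_at_dom bumps_at_S by metis

lemma local_inverse:
  assumes "b \<in> bumps_at g"
  obtains s V where "s \<in> S" "m s b \<in> D" "m b s \<in> D" "openin T V" "ginv G g \<in> V" "V \<subseteq> arrows G"
    "\<And>h. h \<in> V \<Longrightarrow> ginv G h \<in> dom b \<and> h \<in> dom s \<and> is_inverse (the (s h)) (the (b (ginv G h)))"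
proof -
  obtain s where s: "s \<in> S" "m b s \<in> Z_part G A" "m s b \<in> Z_part G A"
    "ginv G g \<in> T interior_of {h \<in> arrows G. ginv G h \<in> dom b \<and> h \<in> dom s \<and>
       is_inverse (the (s h)) (the (b (ginv G h)))}" (is "_ \<in> T interior_of ?W")
    using bumpy assms unfolding Z_bumpy_def Z_involutive_def bumps_at_def by blast
  show thesis
  proof (rule that)
    show "m s b \<in> D" "m b s \<in> D" using s by (auto simp: Z_part_def D_part_def)
    show "T interior_of ?W \<subseteq> arrows G" using interior_of_subset by fast
    show "ginv G h \<in> dom b \<and> h \<in> dom s \<and> is_inverse (the (s h)) (the (b (ginv G h)))"
      if "h \<in> T interior_of ?W" for h using that interior_of_subset[of T ?W] by blast
  qed (use s in auto)
qed

lemma open_arrows: "openin T (arrows G)"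
  using topspace_T openin_topspace by metis

text \<open>Let \<open>c\<close> be a bump at \<open>g\<inverse>\<close> supported in \<open>U\<close>. A local inverse of \<open>c\<close> agrees with the
  inverses of the values of \<open>c\<close> on a neighbourhood of \<open>g\<close>, so the inverses of the arrows in that
  neighbourhood belong to \<open>dom c \<subseteq> U\<close>.\<close>

lemma continuous_inv: "continuous_map T T (ginv G)"
  unfolding continuous_map_def
proof (intro conjI allI impI)
  show "ginv G \<in> topspace T \<rightarrow> topspace T" using inv_closed topspace_T by auto
  fix U assume U: "openin T U"
  show "openin T {g \<in> topspace T. ginv G g \<in> U}"
  proof (subst openin_subopen, intro ballI)
    fix g assume "g \<in> {g \<in> topspace T. ginv G g \<in> U}"
    then have g: "g \<in> arrows G" "ginv G g \<in> U" by (auto simp: topspace_T)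
    obtain c where c: "c \<in> bumps_at (ginv G g)" "dom c \<subseteq> U" using bump[OF U g(2)] .
    obtain s V where V: "openin T V" "ginv G (ginv G g) \<in> V" "V \<subseteq> arrows G"
      "\<And>h. h \<in> V \<Longrightarrow> ginv G h \<in> dom c" using local_inverse[OF c(1)] by metis
    show "\<exists>V. openin T V \<and> g \<in> V \<and> V \<subseteq> {g \<in> topspace T. ginv G g \<in> U}"
      using V c g topspace_T by (intro exI[of _ V]) (auto simp: inv_inv)
  qed
qed

lemma open_inv_preimage: "openin T U \<Longrightarrow> openin T {g \<in> arrows G. ginv G g \<in> U}"
  using openin_continuous_map_preimage[OF continuous_inv] topspace_T by simp

text \<open>Products of open sets are unions of sets \<open>dom a dom b = dom (ab)\<close> with
  \<open>a, b \<in> S\<close>, and every element of \<open>A\<close> has an open domain.\<close>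

lemma open_set_gmult:
  assumes "openin T U" "openin T V"
  shows "openin T (set_gmult G U V)"
proof (subst openin_subopen, intro ballI)
  fix k assume "k \<in> set_gmult G U V"
  then obtain g h where gh: "g \<in> U" "h \<in> V" "gsrc G g = grng G h" "k = gmult G g h"
    by (auto simp: set_gmult_def)
  obtain a b where a: "a \<in> S" "g \<in> dom a" "dom a \<subseteq> U" and b: "b \<in> S" "h \<in> dom b" "dom b \<subseteq> V"
    using basic[OF assms(1) gh(1)] basic[OF assms(2) gh(2)] by metis
  have "a \<in> A" "b \<in> A" using a b S_sub_A by auto
  then have "dom (m a b) = set_gmult G (dom a) (dom b)" "openin T (dom (m a b))"
    using dom_mult[of a b] open_dom[OF mult_A[of a b]] a(1) by auto
  moreover have "set_gmult G (dom a) (dom b) \<subseteq> set_gmult G U V"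
    using a b unfolding set_gmult_def by blast
  ultimately show "\<exists>W. openin T W \<and> k \<in> W \<and> W \<subseteq> set_gmult G U V"
    using set_gmultI[OF a(2) b(2) gh(3)] gh(4) by metis
qed

text \<open>Near a unit \<open>g\<inverse>g\<close> the product of a bump at \<open>g\<close> with a local inverse of it is
  supported on an open set of units.\<close>

lemma open_units: "openin T (gunits G)"
proof (subst openin_subopen, intro ballI)
  fix u assume "u \<in> gunits G"
  then obtain g where g: "g \<in> arrows G" "u = gsrc G g" by (auto simp: gunits_def)
  obtain b where b: "b \<in> bumps_at g" using bump[OF open_arrows g(1)] by metis
  obtain s V where s: "s \<in> S" "m s b \<in> D" "ginv G g \<in> V" "\<And>h. h \<in> V \<Longrightarrow> h \<in> dom s"
    using local_inverse[OF b] by metis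
  have bA: "b \<in> A" "s \<in> A" using b s bumps_at_S S_sub_A by auto
  have "gmult G (ginv G g) g \<in> set_gmult G (dom s) (dom b)"
    using s bumps_at_dom[OF b] src_inv[OF g(1)] by (intro set_gmultI) auto
  then have "u \<in> dom (m s b)" using g dom_mult[OF bA(2,1)] s(1) by (simp add: gsrc_def)
  moreover have "openin T (dom (m s b))" "dom (m s b) \<subseteq> gunits G"
    using mult_A bA s D_dom open_dom by auto
  ultimately show "\<exists>W. openin T W \<and> u \<in> W \<and> W \<subseteq> gunits G" by blast
qed

lemma open_src_image:
  assumes "openin T U"
  shows "openin T (gsrc G ` U)"
proof -
  have "U \<subseteq> arrows G" using assms openin_subset topspace_T by metis
  then show ?thesis
    using open_set_gmult[OF open_arrows assms] open_units by (simp add: src_image_eq openin_Int)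
qed

lemma open_rng_image:
  assumes "openin T U"
  shows "openin T (grng G ` U)"
proof -
  have "U \<subseteq> arrows G" using assms openin_subset topspace_T by metis
  then show ?thesis
    using open_set_gmult[OF assms open_arrows] open_units by (simp add: rng_image_eq openin_Int)
qed

text \<open>If \<open>dom a\<close> is a neighbourhood of \<open>gh\<close> and \<open>dom b\<close> is a bisection containing \<open>g\<inverse>\<close>, then
  \<open>dom (ba)\<close> is a neighbourhood of \<open>h\<close>, and \<open>(dom b)\<inverse> dom (ba) \<subseteq> dom a\<close>.\<close>

lemma mult_neighbourhoods:
  assumes "openin T U" "g \<in> arrows G" "h \<in> arrows G" "gsrc G g = grng G h" "gmult G g h \<in> U"
  obtains V W where "openin T V" "g \<in> V" "openin T W" "h \<in> W"
    "\<And>x y. x \<in> V \<Longrightarrow> y \<in> W \<Longrightarrow> gsrc G x = grng G y \<Longrightarrow> gmult G x y \<in> U"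
proof -
  obtain a where a: "a \<in> S" "gmult G g h \<in> dom a" "dom a \<subseteq> U" using basic[OF assms(1,5)] .
  obtain b where b: "b \<in> S" "ginv G g \<in> dom b"
    using basic[OF open_arrows inv_closed[OF assms(2)]] by metis
  have ab: "a \<in> A" "b \<in> A" using a b S_sub_A by auto
  define V where "V = {x \<in> arrows G. ginv G x \<in> dom b}"
  define W where "W = dom (m b a)"
  have W: "W = set_gmult G (dom b) (dom a)" using dom_mult a b ab W_def by simp
  show thesis
  proof
    show "openin T V" using open_inv_preimage open_dom ab V_def by auto
    show "openin T W" using open_dom mult_A ab W_def by auto
    show "g \<in> V" using assms b V_def by auto
    have "gmult G (ginv G g) (gmult G g h) \<in> set_gmult G (dom b) (dom a)"
      using a b assms src_inv rng_mult by (intro set_gmultI) auto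
    then show "h \<in> W" using inv_mult_cancel assms W by simp
    fix x y assume x: "x \<in> V" and y: "y \<in> W" and xy: "gsrc G x = grng G y"
    obtain b' a' where y': "b' \<in> dom b" "a' \<in> dom a" "gsrc G b' = grng G a'" "y = gmult G b' a'"
      using y W by (auto simp: set_gmult_def)
    have arr: "x \<in> arrows G" "b' \<in> arrows G" "a' \<in> arrows G" "ginv G x \<in> dom b"
      using x y' dom_arrows ab V_def by auto
    have "inj_on (grng G) (dom b)" using b(1) by (simp add: S_part_def bisection_iff)
    moreover have "grng G (ginv G x) = grng G b'"
      using xy y' arr rng_inv rng_mult by simp
    ultimately have "ginv G x = b'" using arr y' by (simp add: inj_on_eq_iff)
    then have "x = ginv G b'" using inv_inv[OF arr(1)] by simp
    then have "gmult G x y = a'" using inv_mult_cancel[OF arr(2,3) y'(3)] y'(4) by simp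
    then show "gmult G x y \<in> U" using y' a by auto
  qed
qed

lemma continuous_mult:
  "continuous_map (subtopology (prod_topology T T) (composable_pairs G)) T (\<lambda>(g, h). gmult G g h)"
  unfolding continuous_map_def
proof (intro conjI allI impI)
  let ?P = "subtopology (prod_topology T T) (composable_pairs G)"
  have top: "topspace ?P = composable_pairs G"
    by (auto simp: topspace_T composable_pairs_def)
  show "(\<lambda>(g, h). gmult G g h) \<in> topspace ?P \<rightarrow> topspace T"
    unfolding top by (auto simp: composable_pairs_def topspace_T mult_closed)
  fix U assume U: "openin T U"
  show "openin ?P {p \<in> topspace ?P. (case p of (g, h) \<Rightarrow> gmult G g h) \<in> U}"
    unfolding top
  proof (subst openin_subopen, intro ballI)
    fix p assume "p \<in> {p \<in> composable_pairs G. (case p of (g, h) \<Rightarrow> gmult G g h) \<in> U}"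
    then obtain g h where p: "p = (g, h)" "g \<in> arrows G" "h \<in> arrows G" "gsrc G g = grng G h"
      "gmult G g h \<in> U" by (auto simp: composable_pairs_def)
    obtain V W where VW: "openin T V" "g \<in> V" "openin T W" "h \<in> W"
      "\<And>x y. x \<in> V \<Longrightarrow> y \<in> W \<Longrightarrow> gsrc G x = grng G y \<Longrightarrow> gmult G x y \<in> U"
      using mult_neighbourhoods[OF U p(2-5)] by metis
    have "openin ?P ((V \<times> W) \<inter> composable_pairs G)"
      using VW by (intro openin_subtopology_Int) (simp add: openin_prod_Times_iff)
    then show "\<exists>N. openin ?P N \<and> p \<in> N \<and>
        N \<subseteq> {p \<in> composable_pairs G. (case p of (g, h) \<Rightarrow> gmult G g h) \<in> U}"
      using VW p by (intro exI[of _ "(V \<times> W) \<inter> composable_pairs G"])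
        (auto simp: composable_pairs_def)
  qed
qed

lemma open_src_preimage:
  assumes "openin T U"
  shows "openin T {g \<in> arrows G. gsrc G g \<in> U}"
proof (subst openin_subopen, intro ballI)
  fix g assume "g \<in> {g \<in> arrows G. gsrc G g \<in> U}"
  then have g: "g \<in> arrows G" "gmult G (ginv G g) g \<in> U" by (auto simp: gsrc_def)
  obtain V W where VW: "openin T V" "ginv G g \<in> V" "openin T W" "g \<in> W"
    "\<And>x y. x \<in> V \<Longrightarrow> y \<in> W \<Longrightarrow> gsrc G x = grng G y \<Longrightarrow> gmult G x y \<in> U"
    using mult_neighbourhoods[OF assms inv_closed[OF g(1)] g(1) src_inv[OF g(1)] g(2)] by metis
  have "openin T ({x \<in> arrows G. ginv G x \<in> V} \<inter> W)"
    using VW open_inv_preimage by auto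
  moreover have "{x \<in> arrows G. ginv G x \<in> V} \<inter> W \<subseteq> {g \<in> arrows G. gsrc G g \<in> U}"
    using VW(5) src_inv by (auto simp: gsrc_def)
  ultimately show "\<exists>N. openin T N \<and> g \<in> N \<and> N \<subseteq> {g \<in> arrows G. gsrc G g \<in> U}"
    using VW g by (intro exI[of _ "{x \<in> arrows G. ginv G x \<in> V} \<inter> W"]) auto
qed

lemma open_rng_preimage:
  assumes "openin T U"
  shows "openin T {g \<in> arrows G. grng G g \<in> U}"
proof -
  have "{g \<in> arrows G. grng G g \<in> U} = {g \<in> arrows G. ginv G g \<in> {g \<in> arrows G. gsrc G g \<in> U}}"
    by (auto simp: src_inv inv_closed)
  then show ?thesis using open_inv_preimage[OF open_src_preimage[OF assms]] by simp
qed

theorem etale: "etale G T"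
  unfolding etale_def
proof (intro conjI)
  show "openin T (gsrc G ` arrows G)" using open_units by (simp add: gunits_def)
  let ?X = "subtopology T (gsrc G ` arrows G)"
  have "continuous_map T T (gsrc G)"
    using src_closed open_src_preimage by (auto simp: continuous_map_def topspace_T)
  then have cont: "continuous_map T ?X (gsrc G)"
    by (intro continuous_map_into_subtopology) (auto simp: topspace_T)
  have openm: "open_map T ?X (gsrc G)"
    unfolding open_map_def
  proof (intro allI impI)
    fix U assume U: "openin T U"
    then have "gsrc G ` U \<subseteq> gsrc G ` arrows G" using openin_subset topspace_T by blast
    then show "openin ?X (gsrc G ` U)"
      using open_src_image[OF U] by (simp add: openin_open_subtopology open_units flip: gunits_def)
  qed
  show "local_homeomorphism T ?X (gsrc G)"
    unfolding local_homeomorphism_def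
  proof (intro ballI)
    fix g assume "g \<in> topspace T"
    then obtain a where a: "a \<in> S" "g \<in> dom a" using basic[OF openin_topspace] by metis
    let ?U = "dom a"
    have U: "openin T ?U" "inj_on (gsrc G) ?U" "?U \<subseteq> arrows G"
      using a S_sub_A open_dom dom_arrows by (auto simp: S_part_def bisection_iff)
    have img: "openin ?X (gsrc G ` ?U)" using openm U by (simp add: open_map_def)
    have "homeomorphic_map (subtopology T ?U) (subtopology ?X (gsrc G ` ?U)) (gsrc G)"
    proof (rule bijective_open_imp_homeomorphic_map)
      show "continuous_map (subtopology T ?U) (subtopology ?X (gsrc G ` ?U)) (gsrc G)"
        by (rule continuous_map_into_subtopology[OF continuous_map_from_subtopology[OF cont]]) auto
      show "open_map (subtopology T ?U) (subtopology ?X (gsrc G ` ?U)) (gsrc G)"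
        by (rule open_map_into_subtopology[OF open_map_from_subtopology[OF openm U(1)]]) auto
      show "gsrc G ` topspace (subtopology T ?U) = topspace (subtopology ?X (gsrc G ` ?U))"
        using U topspace_T src_closed by (auto simp: Int_absorb1)
      show "inj_on (gsrc G) (topspace (subtopology T ?U))"
        using U by (auto intro: inj_on_subset)
    qed
    then show "\<exists>U. openin T U \<and> g \<in> U \<and> openin ?X (gsrc G ` U) \<and>
        homeomorphic_map (subtopology T U) (subtopology ?X (gsrc G ` U)) (gsrc G)"
      using U img a by blast
  qed
qed (rule continuous_inv continuous_mult)+

end

section \<open>Normalisers in terms of the diagonal\<close>

text \<open>Two points \<open>g, h\<close> in one fibre of \<open>p\<close> with distinct images under \<open>q\<close> give a nonempty open
  set \<open>W\<close> over all of which \<open>p\<close> has points of \<open>U\<close> that \<open>q\<close> maps into \<open>O\<^sub>1\<close>, and also ones that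
  \<open>q\<close> maps into the disjoint set \<open>O\<^sub>2\<close>. Conversely, the first property yields points over
  a nonempty open subset of \<open>W\<close>, and the second property over that subset a point in the fibre of
  one of them. Thus a condition on individual points becomes one on basic open sets.\<close>

lemma fibre_not_constant_iff:
  assumes U: "openin X U"
    and open_p: "\<And>V. openin X V \<Longrightarrow> openin Y (p ` V)"
    and cont_p: "\<And>W. openin Y W \<Longrightarrow> openin X {g \<in> U. p g \<in> W}"
    and cont_q: "\<And>W. openin Y W \<Longrightarrow> openin X {g \<in> U. q g \<in> W}"
    and Hausdorff: "Hausdorff_space Y" and q: "q ` U \<subseteq> topspace Y"
    and \<B>_open: "\<And>V. V \<in> \<B> \<Longrightarrow> openin Y V"
    and \<B>_basic: "\<And>V y. openin Y V \<Longrightarrow> y \<in> V \<Longrightarrow> \<exists>B\<in>\<B>. y \<in> B \<and> B \<subseteq> V"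
  shows "(\<exists>g\<in>U. \<exists>h\<in>U. p g = p h \<and> q g \<noteq> q h) \<longleftrightarrow>
    (\<exists>O1\<in>\<B>. \<exists>O2\<in>\<B>. \<exists>W\<in>\<B>. O1 \<inter> O2 = {} \<and> W \<noteq> {} \<and>
      (\<forall>V\<in>\<B>. W \<inter> V \<noteq> {} \<longrightarrow>
        (\<exists>g\<in>U. q g \<in> O1 \<and> p g \<in> W \<inter> V) \<and> (\<exists>g\<in>U. q g \<in> O2 \<and> p g \<in> W \<inter> V)))"
    (is "?L \<longleftrightarrow> ?R")
proof
  assume ?L
  then obtain g h where gh: "g \<in> U" "h \<in> U" "p g = p h" "q g \<noteq> q h" by blast
  moreover have "q g \<in> topspace Y" "q h \<in> topspace Y" using gh q by auto
  ultimately obtain V1 V2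
    where V: "openin Y V1" "openin Y V2" "q g \<in> V1" "q h \<in> V2" "disjnt V1 V2"
    using Hausdorff unfolding Hausdorff_space_def by metis
  obtain O1 O2 where O: "O1 \<in> \<B>" "q g \<in> O1" "O1 \<subseteq> V1" "O2 \<in> \<B>" "q h \<in> O2" "O2 \<subseteq> V2"
    using \<B>_basic[OF V(1,3)] \<B>_basic[OF V(2,4)] by blast
  define W0 where "W0 = p ` {g \<in> U. q g \<in> O1} \<inter> p ` {g \<in> U. q g \<in> O2}"
  have W0_open: "openin Y W0"
    unfolding W0_def using O by (intro openin_Int open_p cont_q \<B>_open)
  have "p g \<in> p ` {g \<in> U. q g \<in> O1}" using gh(1) O(2) by blast
  moreover have "p g \<in> p ` {g \<in> U. q g \<in> O2}" unfolding gh(3) using gh(2) O(5) by blast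
  ultimately have W0_mem: "p g \<in> W0" by (simp add: W0_def)
  have W0: "\<exists>x\<in>U. q x \<in> O1 \<and> p x = y" "\<exists>x\<in>U. q x \<in> O2 \<and> p x = y" if "y \<in> W0" for y
    using that unfolding W0_def by auto
  obtain W where W: "W \<in> \<B>" "p g \<in> W" "W \<subseteq> W0" using \<B>_basic[OF W0_open W0_mem] by blast
  have WV: "(\<exists>g\<in>U. q g \<in> O1 \<and> p g \<in> W \<inter> V) \<and> (\<exists>g\<in>U. q g \<in> O2 \<and> p g \<in> W \<inter> V)"
    if "W \<inter> V \<noteq> {}" for V
  proof -
    obtain y where y: "y \<in> W \<inter> V" using \<open>W \<inter> V \<noteq> {}\<close> by auto
    then have "y \<in> W0" using W(3) by auto
    from W0[OF this] show ?thesis using y by metis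
  qed
  have disj: "O1 \<inter> O2 = {}" using O V(5) by (auto simp: disjnt_def)
  have ne: "W \<noteq> {}" using W(2) by auto
  show ?R
    by (intro bexI[OF _ O(1)] bexI[OF _ O(4)] bexI[OF _ W(1)] conjI disj ne ballI impI WV)
next
  assume ?R
  then obtain O1 O2 W where *: "O1 \<in> \<B>" "O2 \<in> \<B>" "W \<in> \<B>" "O1 \<inter> O2 = {}" "W \<noteq> {}"
    "\<And>V. V \<in> \<B> \<Longrightarrow> W \<inter> V \<noteq> {} \<Longrightarrow>
        (\<exists>g\<in>U. q g \<in> O1 \<and> p g \<in> W \<inter> V) \<and> (\<exists>g\<in>U. q g \<in> O2 \<and> p g \<in> W \<inter> V)" by metis
  obtain g where g: "g \<in> U" "q g \<in> O1" "p g \<in> W" using *(6)[OF *(3)] *(5) by auto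
  define V0 where "V0 = p ` ({g \<in> U. q g \<in> O1} \<inter> {g \<in> U. p g \<in> W})"
  have V0_open: "openin Y V0"
    unfolding V0_def using * by (intro open_p openin_Int cont_q cont_p \<B>_open)
  have V0_mem: "p g \<in> V0" using g by (simp add: V0_def)
  have V0: "\<exists>x\<in>U. q x \<in> O1 \<and> p x = y" if "y \<in> V0" for y
    using that unfolding V0_def by auto
  obtain V where V: "V \<in> \<B>" "p g \<in> V" "V \<subseteq> V0" using \<B>_basic[OF V0_open V0_mem] by blast
  have "W \<inter> V \<noteq> {}" using V(2) g(3) by auto
  then obtain h where h: "h \<in> U" "q h \<in> O2" "p h \<in> V" using *(6)[OF V(1)] by auto
  obtain g' where g': "g' \<in> U" "q g' \<in> O1" "p g' = p h" using V0 V(3) h(3) by blast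
  have "q g' \<noteq> q h" using g' h *(4) by auto
  then show ?L using g' h by metis
qed

text \<open>With \<open>z\<close> the empty function and \<open>D\<close> the diagonal, this expresses that two arrows in the
  domain of \<open>a\<close> have the same source but distinct ranges; the opposite product exchanges source and
  range. The condition mentions only the product, \<open>z\<close> and \<open>D\<close>, so isomorphisms preserve it.\<close>

definition branches :: "('a \<Rightarrow> 'a \<Rightarrow> 'a) \<Rightarrow> 'a \<Rightarrow> 'a set \<Rightarrow> 'a \<Rightarrow> bool"
  where "branches m z D a \<longleftrightarrow> (\<exists>d\<in>D. \<exists>d'\<in>D. \<exists>e\<in>D. m d d' = z \<and> e \<noteq> z \<and>
    (\<forall>e'\<in>D. m e e' \<noteq> z \<longrightarrow> m d (m a (m e e')) \<noteq> z \<and> m d' (m a (m e e')) \<noteq> z))"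

context bumpy_semigroup
begin

lemma D_basic:
  assumes "openin (subtopology T (gunits G)) V" "y \<in> V"
  shows "\<exists>B \<in> dom ` D. y \<in> B \<and> B \<subseteq> V"
proof -
  have V: "openin T V" "V \<subseteq> gunits G" using assms by (auto simp: openin_open_subtopology open_units)
  obtain a where "a \<in> S" "y \<in> dom a" "dom a \<subseteq> V" using basic[OF V(1) assms(2)] .
  then show ?thesis using V S_sub_A by (auto simp: D_part_def)
qed

lemma D_open: "B \<in> dom ` D \<Longrightarrow> openin (subtopology T (gunits G)) B"
  using open_dom by (auto simp: D_part_def openin_open_subtopology open_units)

lemma open_src_rng:
  assumes "openin T V"
  shows "openin (subtopology T (gunits G)) (gsrc G ` V)"
    and "openin (subtopology T (gunits G)) (grng G ` V)"
proof -
  have "V \<subseteq> arrows G" using assms openin_subset topspace_T by metis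
  then show "openin (subtopology T (gunits G)) (gsrc G ` V)"
    and "openin (subtopology T (gunits G)) (grng G ` V)"
    using open_src_image[OF assms] open_rng_image[OF assms] src_in_units rng_in_units
    by (auto simp: openin_open_subtopology open_units)
qed

lemma open_src_rng_preimage:
  assumes "openin T U" "openin (subtopology T (gunits G)) W"
  shows "openin T {g \<in> U. gsrc G g \<in> W}" and "openin T {g \<in> U. grng G g \<in> W}"
proof -
  have W: "openin T W" using assms by (auto simp: openin_open_subtopology open_units)
  have "U \<subseteq> arrows G" using assms openin_subset topspace_T by metis
  then have "{g \<in> U. gsrc G g \<in> W} = U \<inter> {g \<in> arrows G. gsrc G g \<in> W}"
    "{g \<in> U. grng G g \<in> W} = U \<inter> {g \<in> arrows G. grng G g \<in> W}" by auto
  then show "openin T {g \<in> U. gsrc G g \<in> W}" and "openin T {g \<in> U. grng G g \<in> W}"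
    using open_src_preimage[OF W] open_rng_preimage[OF W] assms(1) by auto
qed

text \<open>The product \<open>d a f\<close> is nonempty iff some arrow in \<open>dom a\<close> has its range in \<open>dom d\<close> and its
  source in \<open>dom f\<close>; so \<open>branches\<close> is the condition of \<open>fibre_not_constant_iff\<close> for the basis of
  all \<open>dom d\<close> with \<open>d \<in> D\<close>.\<close>

lemma branches_iff:
  assumes a: "a \<in> A"
  shows "branches m Map.empty D a \<longleftrightarrow>
      (\<exists>g\<in>dom a. \<exists>h\<in>dom a. gsrc G g = gsrc G h \<and> grng G g \<noteq> grng G h)" (is ?src)
    and "branches (\<lambda>x y. m y x) Map.empty D a \<longleftrightarrow>
      (\<exists>g\<in>dom a. \<exists>h\<in>dom a. grng G g = grng G h \<and> gsrc G g \<noteq> gsrc G h)" (is ?rng)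
proof -
  have arr: "gsrc G ` dom a \<subseteq> topspace (subtopology T (gunits G))"
    "grng G ` dom a \<subseteq> topspace (subtopology T (gunits G))"
    using dom_arrows[OF a] src_in_units rng_in_units units_sub topspace_T by auto
  have zero: "x \<noteq> Map.empty \<longleftrightarrow> dom x \<noteq> {}" for x :: "'g \<rightharpoonup> 'y"
    by simp
  have src: "m d (m a f) \<noteq> Map.empty \<longleftrightarrow> (\<exists>g\<in>dom a. grng G g \<in> dom d \<and> gsrc G g \<in> dom f)"
    if "d \<in> D" "f \<in> D" for d f
  proof -
    have "f \<in> A" using that D_sub_S S_sub_A by auto
    then have "dom (m d (m a f)) = {g \<in> dom a. grng G g \<in> dom d \<and> gsrc G g \<in> dom f}"
      using dom_mult_D_left[OF mult_A[OF a, of f] that(1)] dom_mult_D_right[OF a that(2)] by auto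
    then show ?thesis unfolding zero by auto
  qed
  have rng: "m (m f a) d \<noteq> Map.empty \<longleftrightarrow> (\<exists>g\<in>dom a. gsrc G g \<in> dom d \<and> grng G g \<in> dom f)"
    if "d \<in> D" "f \<in> D" for d f
  proof -
    have "f \<in> A" using that D_sub_S S_sub_A by auto
    then have "dom (m (m f a) d) = {g \<in> dom a. gsrc G g \<in> dom d \<and> grng G g \<in> dom f}"
      using dom_mult_D_right[OF mult_A[OF _ a, of f] that(1)] dom_mult_D_left[OF a that(2)] by auto
    then show ?thesis unfolding zero by auto
  qed
  have DD: "m d e = Map.empty \<longleftrightarrow> dom d \<inter> dom e = {}" if "d \<in> D" "e \<in> D" for d e
    by (simp only: dom_eq_empty_conv[symmetric] dom_mult_D_D[OF that])
  have DD': "m e d = Map.empty \<longleftrightarrow> dom d \<inter> dom e = {}" if "d \<in> D" "e \<in> D" for d e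
    using DD[OF that(2,1)] by (simp add: Int_commute)
  have srcs: "(\<forall>e'\<in>D. m e e' \<noteq> Map.empty \<longrightarrow>
        m d (m a (m e e')) \<noteq> Map.empty \<and> m d' (m a (m e e')) \<noteq> Map.empty) \<longleftrightarrow>
      (\<forall>e'\<in>D. dom e \<inter> dom e' \<noteq> {} \<longrightarrow>
        (\<exists>g\<in>dom a. grng G g \<in> dom d \<and> gsrc G g \<in> dom e \<inter> dom e') \<and>
        (\<exists>g\<in>dom a. grng G g \<in> dom d' \<and> gsrc G g \<in> dom e \<inter> dom e'))"
    if "d \<in> D" "d' \<in> D" "e \<in> D" for d d' e
  proof (intro ball_cong refl)
    fix e' assume "e' \<in> D"
    then show "(m e e' \<noteq> Map.empty \<longrightarrow>
        m d (m a (m e e')) \<noteq> Map.empty \<and> m d' (m a (m e e')) \<noteq> Map.empty) \<longleftrightarrow>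
      (dom e \<inter> dom e' \<noteq> {} \<longrightarrow>
        (\<exists>g\<in>dom a. grng G g \<in> dom d \<and> gsrc G g \<in> dom e \<inter> dom e') \<and>
        (\<exists>g\<in>dom a. grng G g \<in> dom d' \<and> gsrc G g \<in> dom e \<inter> dom e'))"
      using that by (simp only: src D_mult DD dom_mult_D_D)
  qed
  have rngs: "(\<forall>e'\<in>D. m e' e \<noteq> Map.empty \<longrightarrow>
        m (m (m e' e) a) d \<noteq> Map.empty \<and> m (m (m e' e) a) d' \<noteq> Map.empty) \<longleftrightarrow>
      (\<forall>e'\<in>D. dom e \<inter> dom e' \<noteq> {} \<longrightarrow>
        (\<exists>g\<in>dom a. gsrc G g \<in> dom d \<and> grng G g \<in> dom e \<inter> dom e') \<and>
        (\<exists>g\<in>dom a. gsrc G g \<in> dom d' \<and> grng G g \<in> dom e \<inter> dom e'))"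
    if "d \<in> D" "d' \<in> D" "e \<in> D" for d d' e
  proof (intro ball_cong refl)
    fix e' assume "e' \<in> D"
    then show "(m e' e \<noteq> Map.empty \<longrightarrow>
        m (m (m e' e) a) d \<noteq> Map.empty \<and> m (m (m e' e) a) d' \<noteq> Map.empty) \<longleftrightarrow>
      (dom e \<inter> dom e' \<noteq> {} \<longrightarrow>
        (\<exists>g\<in>dom a. gsrc G g \<in> dom d \<and> grng G g \<in> dom e \<inter> dom e') \<and>
        (\<exists>g\<in>dom a. gsrc G g \<in> dom d' \<and> grng G g \<in> dom e \<inter> dom e'))"
      using that by (simp only: rng D_mult DD dom_mult_D_D Int_commute[of "dom e'" "dom e"])
  qed
  have "branches m Map.empty D a \<longleftrightarrow> (\<exists>O1\<in>dom ` D. \<exists>O2\<in>dom ` D. \<exists>W\<in>dom ` D.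
      O1 \<inter> O2 = {} \<and> W \<noteq> {} \<and> (\<forall>V\<in>dom ` D. W \<inter> V \<noteq> {} \<longrightarrow>
        (\<exists>g\<in>dom a. grng G g \<in> O1 \<and> gsrc G g \<in> W \<inter> V) \<and>
        (\<exists>g\<in>dom a. grng G g \<in> O2 \<and> gsrc G g \<in> W \<inter> V)))"
    unfolding branches_def bex_simps(7) ball_simps(9)
    by (intro bex_cong conj_cong refl srcs DD zero)
  also have "\<dots> \<longleftrightarrow> (\<exists>g\<in>dom a. \<exists>h\<in>dom a. gsrc G g = gsrc G h \<and> grng G g \<noteq> grng G h)"
    by (rule fibre_not_constant_iff[symmetric, OF open_dom[OF a] open_src_rng(1)
          open_src_rng_preimage(1)[OF open_dom[OF a]] open_src_rng_preimage(2)[OF open_dom[OF a]]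
          Hausdorff_units arr(2) D_open D_basic])
  finally show ?src .
  have "branches (\<lambda>x y. m y x) Map.empty D a \<longleftrightarrow>
      (\<exists>O1\<in>dom ` D. \<exists>O2\<in>dom ` D. \<exists>W\<in>dom ` D.
      O1 \<inter> O2 = {} \<and> W \<noteq> {} \<and> (\<forall>V\<in>dom ` D. W \<inter> V \<noteq> {} \<longrightarrow>
        (\<exists>g\<in>dom a. gsrc G g \<in> O1 \<and> grng G g \<in> W \<inter> V) \<and>
        (\<exists>g\<in>dom a. gsrc G g \<in> O2 \<and> grng G g \<in> W \<inter> V)))"
    unfolding branches_def bex_simps(7) ball_simps(9)
    by (intro bex_cong conj_cong refl rngs DD' zero)
  also have "\<dots> \<longleftrightarrow> (\<exists>g\<in>dom a. \<exists>h\<in>dom a. grng G g = grng G h \<and> gsrc G g \<noteq> gsrc G h)"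
    by (rule fibre_not_constant_iff[symmetric, OF open_dom[OF a] open_src_rng(2)
          open_src_rng_preimage(2)[OF open_dom[OF a]] open_src_rng_preimage(1)[OF open_dom[OF a]]
          Hausdorff_units arr(1) D_open D_basic])
  finally show ?rng .
qed

lemma N_part_eq:
  "N_part G A = {a \<in> A. \<not> branches m Map.empty D a \<and> \<not> branches (\<lambda>x y. m y x) Map.empty D a}"
proof -
  have "isosection G (dom a) \<longleftrightarrow>
      \<not> branches m Map.empty D a \<and> \<not> branches (\<lambda>x y. m y x) Map.empty D a"
    if a: "a \<in> A" for a
    unfolding isosection_iff branches_iff[OF a] using dom_arrows[OF a] by blast
  then show ?thesis unfolding N_part_def by blast
qed

end

section \<open>Domination and the filters of points\<close>

lemma one_sided_inverse:
  fixes x y :: "'y::one_cancellative"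
  assumes "x * y = 1"
  shows "is_inverse x y"
proof -
  have "(y * x) * y = y" using assms by (simp add: mult.assoc)
  then show ?thesis using assms by (simp add: is_inverse_def mult_eq_right_iff)
qed

text \<open>The element \<open>s\<close> acts as an inverse of \<open>b\<close> on the domain of \<open>a\<close>: the last equation says
  that \<open>sb\<close> is \<open>1\<close> at the sources of \<open>dom a\<close>, and \<open>as \<in> D\<close> makes \<open>dom a\<close> a part of \<open>dom b\<close>.\<close>

definition dominated :: "('a \<Rightarrow> 'a \<Rightarrow> 'a) \<Rightarrow> 'a set \<Rightarrow> 'a set \<Rightarrow> 'a \<Rightarrow> 'a \<Rightarrow> bool"
  where "dominated m D S a b \<longleftrightarrow> (\<exists>s\<in>S. m s b \<in> D \<and> m a s \<in> D \<and> m a (m s b) = a)"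

definition domination_filter :: "('a \<Rightarrow> 'a \<Rightarrow> 'a) \<Rightarrow> 'a \<Rightarrow> 'a set \<Rightarrow> 'a set \<Rightarrow> 'a set \<Rightarrow> bool"
  where "domination_filter m z D S U \<longleftrightarrow> U \<subseteq> S \<and> U \<noteq> {} \<and> z \<notin> U \<and>
    (\<forall>a\<in>U. \<forall>b\<in>U. \<exists>c\<in>U. dominated m D S c a \<and> dominated m D S c b)"

context bumpy_semigroup
begin

text \<open>The compact set is \<open>[1](sb)\<close>. Since \<open>sb\<close> lives on units, a point of its domain is a product
  \<open>k\<inverse> k\<close> with \<open>k \<in> dom b\<close>, hence the source of an arrow of \<open>dom b\<close>.\<close>

lemma dominatedD:
  assumes "a \<in> S" "b \<in> S" "dominated m D S a b"
  shows "dom a \<subseteq> {g \<in> dom b. the (b g) \<in> invertibles}"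
    and "\<exists>K. compactin T K \<and> K \<subseteq> gunits G \<and> gsrc G ` dom a \<subseteq> K \<and> K \<subseteq> gsrc G ` dom b"
proof -
  obtain s where s: "s \<in> S" "m s b \<in> D" "m a s \<in> D" "m a (m s b) = a"
    using assms(3) by (auto simp: dominated_def)
  have A: "a \<in> A" "b \<in> A" "s \<in> A" using assms s S_sub_A by auto
  have dom_sb: "dom (m s b) = set_gmult G (dom s) (dom b)" using dom_mult A assms by simp
  have sb: "\<exists>k. k \<in> dom b \<and> ginv G k \<in> dom s \<and> gsrc G k = u" if u: "u \<in> dom (m s b)" for u
  proof -
    obtain l k where lk: "l \<in> dom s" "k \<in> dom b" "gsrc G l = grng G k" "u = gmult G l k"
      using u dom_sb by (auto simp: set_gmult_def)
    have arr: "l \<in> arrows G" "k \<in> arrows G" using lk A dom_arrows by auto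
    have unit: "u \<in> gunits G" using u D_dom[OF s(2)] by auto
    then have "l = ginv G k" using mult_unitD[OF arr lk(3)] lk(4) by simp
    moreover have "gsrc G k = u" using src_mult[OF arr lk(3)] lk(4) src_unit[OF unit] by simp
    ultimately show ?thesis using lk by blast
  qed
  have main: "g \<in> dom b \<and> the (b g) \<in> invertibles \<and> gsrc G g \<in> level {1} (m s b)"
    if g: "g \<in> dom a" for g
  proof -
    have "g \<in> dom (m a (m s b))" using g s(4) by simp
    then have sg: "gsrc G g \<in> dom (m s b)" using dom_mult_D_right[OF A(1) s(2)] by simp
    have "the (a g) * the (m s b (gsrc G g)) = the (a g)"
      using value_mult_D_right[OF A(1) s(2) g sg] s(4) by simp
    then have one: "the (m s b (gsrc G g)) = 1" by (simp add: mult_eq_left_iff)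
    obtain k where k: "k \<in> dom b" "ginv G k \<in> dom s" "gsrc G k = gsrc G g" using sb[OF sg] by blast
    have arr: "g \<in> arrows G" "k \<in> arrows G" "ginv G k \<in> arrows G"
      using g k A dom_arrows inv_closed by auto
    \<comment> \<open>Here \<open>as \<in> D\<close> forces the arrow of \<open>dom b\<close> with the source of \<open>g\<close> to be \<open>g\<close> itself.\<close>
    have "gmult G g (ginv G k) \<in> set_gmult G (dom a) (dom s)"
      using g k arr by (intro set_gmultI) (auto simp: rng_inv)
    then have "gmult G g (ginv G k) \<in> gunits G"
      using dom_mult[OF A(1,3)] assms(1) D_dom[OF s(3)] by auto
    then have "g = k" using mult_inv_unitD[OF arr(1,2)] k by simp
    have "the (m s b (gmult G (ginv G k) k)) = the (s (ginv G k)) * the (b k)"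
      using value_mult[OF A(3,2) _ k(2,1)] s arr by (simp add: src_inv)
    then have "is_inverse (the (s (ginv G k))) (the (b k))"
      using one k by (intro one_sided_inverse) (simp add: gsrc_def)
    then have "the (b k) \<in> invertibles" by (auto simp: invertibles_def is_inverse_def)
    then show ?thesis using \<open>g = k\<close> k sg one by (simp add: level_def)
  qed
  then show "dom a \<subseteq> {g \<in> dom b. the (b g) \<in> invertibles}" by blast
  have lev: "level {1} (m s b) \<subseteq> dom (m s b)" by (auto simp: level_def)
  have "m s b \<in> S" using s D_sub_S by auto
  then have "compactin T (level {1} (m s b))"
    using bumpy by (simp add: Z_bumpy_def one_proper_def)
  moreover have "level {1} (m s b) \<subseteq> gunits G" using lev D_dom[OF s(2)] by blast
  moreover have "gsrc G ` dom a \<subseteq> level {1} (m s b)" using main by blast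
  moreover have "level {1} (m s b) \<subseteq> gsrc G ` dom b" using lev sb by blast
  ultimately show
    "\<exists>K. compactin T K \<and> K \<subseteq> gunits G \<and> gsrc G ` dom a \<subseteq> K \<and> K \<subseteq> gsrc G ` dom b" by blast
qed

lemma dominated_bumps_at:
  assumes "a \<in> S" "b \<in> S" "dominated m D S a b" "g \<in> dom a"
  shows "b \<in> bumps_at g"
proof -
  have "dom a \<subseteq> level invertibles b" using dominatedD(1)[OF assms(1-3)] by (auto simp: level_def)
  then have "dom a \<subseteq> T interior_of level invertibles b"
    using assms(1) S_sub_A open_dom by (intro interior_of_maximal) auto
  then show ?thesis using assms by (auto simp: bumps_at_def)
qed

text \<open>Every element of \<open>S\<close> supported where \<open>s(h\<inverse>) = b(h)\<inverse>\<close> for a local inverse \<open>s\<close> of \<open>b\<close> is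
  dominated by \<open>b\<close>.\<close>

lemma dominated_locally:
  assumes "b \<in> bumps_at g" "g \<in> arrows G"
  obtains U where "openin T U" "g \<in> U" "\<And>a. a \<in> S \<Longrightarrow> dom a \<subseteq> U \<Longrightarrow> dominated m D S a b"
proof -
  have bS: "b \<in> S" using bumps_at_S assms by auto
  obtain s V where s: "s \<in> S" "m s b \<in> D" and V: "openin T V" "ginv G g \<in> V" "V \<subseteq> arrows G"
    "\<And>h. h \<in> V \<Longrightarrow> ginv G h \<in> dom b \<and> h \<in> dom s \<and> is_inverse (the (s h)) (the (b (ginv G h)))"
    using local_inverse[OF assms(1)] by metis
  define U where "U = {h \<in> arrows G. ginv G h \<in> V}"
  have U: "h \<in> dom b \<and> ginv G h \<in> dom s \<and> the (s (ginv G h)) * the (b h) = 1" if "h \<in> U" for h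
    using V(4)[of "ginv G h"] that inv_inv by (auto simp: U_def is_inverse_def)
  show thesis
  proof
    show "openin T U" unfolding U_def using open_inv_preimage V by auto
    show "g \<in> U" using assms V by (simp add: U_def)
    fix a assume a: "a \<in> S" "dom a \<subseteq> U"
    have A: "a \<in> A" "b \<in> A" "s \<in> A" using a bS s S_sub_A by auto
    have one: "gsrc G h \<in> dom (m s b) \<and> the (m s b (gsrc G h)) = 1" if h: "h \<in> dom a" for h
    proof -
      have "h \<in> U" using h a(2) by blast
      then have *: "h \<in> dom b" "ginv G h \<in> dom s" "the (s (ginv G h)) * the (b h) = 1"
        "h \<in> arrows G" using U by (simp_all add: U_def)
      have "gsrc G h \<in> set_gmult G (dom s) (dom b)"
        unfolding gsrc_def using * src_inv by (intro set_gmultI) auto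
      moreover have "the (m s b (gmult G (ginv G h) h)) = 1"
        using value_mult[OF A(3,2) _ *(2,1) src_inv[OF *(4)]] bS *(3) by simp
      ultimately show ?thesis using dom_mult[OF A(3,2)] bS by (simp add: gsrc_def)
    qed
    have "m a s \<in> D"
    proof (rule DI)
      have "gmult G h k \<in> gunits G" if "h \<in> dom a" "k \<in> dom s" "gsrc G h = grng G k" for h k
      proof -
        have "h \<in> U" using that(1) a(2) by blast
        then have *: "ginv G h \<in> dom s" "h \<in> arrows G" "k \<in> dom s"
          using U that(2) by (simp_all add: U_def)
        moreover have "grng G (ginv G h) = grng G k" using that * rng_inv by simp
        moreover have "inj_on (grng G) (dom s)" using s(1) by (simp add: S_part_def bisection_iff)
        ultimately have "k = ginv G h" by (simp add: inj_on_eq_iff)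
        then show ?thesis using rng_in_units[OF *(2)] by (simp add: grng_def)
      qed
      then show "dom (m a s) \<subseteq> gunits G"
        using dom_mult[OF A(1,3)] a by (auto simp: set_gmult_def)
    qed (use A mult_A in auto)
    moreover have "m a (m s b) = a"
    proof (rule map_le_antisym)
      have d: "dom (m a (m s b)) = dom a"
        using dom_mult_D_right[OF A(1) s(2)] one by blast
      have "m a (m s b) h = a h" if h: "h \<in> dom a" for h
      proof -
        have "the (m a (m s b) h) = the (a h)"
          using value_mult_D_right[OF A(1) s(2) h] one[OF h] by simp
        moreover have "h \<in> dom (m a (m s b))" using d h by simp
        ultimately show ?thesis using h by (metis domD option.sel)
      qed
      then show "m a (m s b) \<subseteq>\<^sub>m a" "a \<subseteq>\<^sub>m m a (m s b)" using d by (auto simp: map_le_def)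
    qed
    ultimately show "dominated m D S a b" using s by (auto simp: dominated_def)
  qed
qed

text \<open>Both members of the filter dominate every bump at \<open>g\<close> whose support is small enough.\<close>

lemma bumps_at_filter:
  assumes g: "g \<in> arrows G"
  shows "domination_filter m Map.empty D S (bumps_at g)"
  unfolding domination_filter_def
proof (intro conjI ballI)
  show "bumps_at g \<subseteq> S" using bumps_at_S by auto
  obtain a where "a \<in> bumps_at g" using bump[OF open_arrows g] .
  then show "bumps_at g \<noteq> {}" by blast
  show "Map.empty \<notin> bumps_at g" using bumps_at_dom[of Map.empty g] by auto
  fix a b assume ab: "a \<in> bumps_at g" "b \<in> bumps_at g"
  obtain U where U: "openin T U" "g \<in> U" "\<And>c. c \<in> S \<Longrightarrow> dom c \<subseteq> U \<Longrightarrow> dominated m D S c a"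
    using dominated_locally[OF ab(1) g] by metis
  obtain V where V: "openin T V" "g \<in> V" "\<And>c. c \<in> S \<Longrightarrow> dom c \<subseteq> V \<Longrightarrow> dominated m D S c b"
    using dominated_locally[OF ab(2) g] by metis
  have "openin T (U \<inter> V)" "g \<in> U \<inter> V" using U V by auto
  then obtain c where "c \<in> bumps_at g" "dom c \<subseteq> U \<inter> V" using bump by metis
  then show "\<exists>c\<in>bumps_at g. dominated m D S c a \<and> dominated m D S c b"
    using U V bumps_at_S by blast
qed

text \<open>If \<open>c\<close> is dominated by \<open>a\<close> then a compact set lies between the sources of their domains.
  By the Hausdorff property these compact sets have a common point, taken over all such pairs in the
  filter, and the arrows with this source in the domains of the members of the filter
  coincide, because any two members dominate a third.\<close>

lemma filter_subset_bumps_at: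
  assumes "domination_filter m Map.empty D S U"
  obtains g where "g \<in> arrows G" "U \<subseteq> bumps_at g"
proof -
  have U: "U \<subseteq> S" "U \<noteq> {}" "Map.empty \<notin> U"
    "\<And>a b. a \<in> U \<Longrightarrow> b \<in> U \<Longrightarrow> \<exists>c\<in>U. dominated m D S c a \<and> dominated m D S c b"
    using assms by (auto simp: domination_filter_def)
  let ?X = "subtopology T (gunits G)"
  have dom_sub: "dom c \<subseteq> dom a" if "c \<in> U" "a \<in> U" "dominated m D S c a" for c a
    using dominatedD(1)[of c a] that U(1) by blast
  define \<K> where "\<K> = {K. compactin ?X K \<and> (\<exists>c\<in>U. gsrc G ` dom c \<subseteq> K)}"
  have below: "\<exists>K\<in>\<K>. K \<subseteq> gsrc G ` dom a" if a: "a \<in> U" for a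
  proof -
    obtain c where c: "c \<in> U" "dominated m D S c a" using U(4)[OF a a] by blast
    have "c \<in> S" "a \<in> S" using c(1) a U(1) by auto
    from dominatedD(2)[OF this c(2)] show ?thesis
      using c(1) by (auto simp: \<K>_def compactin_subtopology)
  qed
  have fin: "\<exists>c\<in>U. gsrc G ` dom c \<subseteq> \<Inter>\<F>" if "finite \<F>" "\<F> \<subseteq> \<K>" for \<F>
    using that
  proof (induction \<F> rule: finite_induct)
    case empty
    then show ?case using U(2) by auto
  next
    case (insert K \<F>)
    then obtain c where c: "c \<in> U" "gsrc G ` dom c \<subseteq> \<Inter>\<F>" by auto
    obtain b where b: "b \<in> U" "gsrc G ` dom b \<subseteq> K" using insert.prems by (auto simp: \<K>_def)
    obtain e where e: "e \<in> U" "dominated m D S e b" "dominated m D S e c"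
      using U(4)[OF b(1) c(1)] by blast
    have "dom e \<subseteq> dom b" "dom e \<subseteq> dom c" using dom_sub e b c by auto
    then have "gsrc G ` dom e \<subseteq> \<Inter>(insert K \<F>)" using b c by blast
    then show ?case using e(1) by blast
  qed
  have ne: "dom c \<noteq> {}" if "c \<in> U" for c using that U(3) by auto
  obtain a0 where a0: "a0 \<in> U" using U(2) by blast
  obtain K0 where K0: "K0 \<in> \<K>" using below[OF a0] by blast
  have fip: "K0 \<inter> \<Inter>\<F> \<noteq> {}" if F: "finite \<F>" "\<F> \<subseteq> \<K>" for \<F>
  proof -
    have "finite (insert K0 \<F>)" "insert K0 \<F> \<subseteq> \<K>" using F K0 by auto
    from fin[OF this] obtain c where c: "c \<in> U" "gsrc G ` dom c \<subseteq> \<Inter>(insert K0 \<F>)" by blast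
    obtain x where "x \<in> dom c" using ne[OF c(1)] by blast
    then show ?thesis using c(2) by blast
  qed
  have closed: "closedin ?X K" if "K \<in> \<K>" for K
    using that compactin_imp_closedin[OF Hausdorff_units] by (simp add: \<K>_def)
  have "compactin ?X K0" using K0 by (simp add: \<K>_def)
  then have "K0 \<inter> \<Inter>\<K> \<noteq> {}"
    by (rule compactin_fip[THEN iffD1, THEN conjunct2, THEN spec, THEN mp])
      (intro conjI ballI allI impI closed fip; simp)
  then obtain u where "u \<in> \<Inter>\<K>" by blast
  then have u: "u \<in> gsrc G ` dom a" if "a \<in> U" for a using below[OF that] by blast
  obtain g where g: "g \<in> dom a0" "gsrc G g = u" using u[OF a0] by blast
  have g_dom: "g \<in> dom a" if a: "a \<in> U" for a
  proof -
    obtain c where c: "c \<in> U" "dominated m D S c a" "dominated m D S c a0" using U(4)[OF a a0] by blast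
    have sub: "dom c \<subseteq> dom a" "dom c \<subseteq> dom a0" using dom_sub c a a0 by auto
    obtain h where h: "h \<in> dom c" "gsrc G h = u" using u[OF c(1)] by blast
    have "inj_on (gsrc G) (dom a0)" using a0 U(1) by (auto simp: S_part_def bisection_iff)
    then have "g = h" using g h sub inj_onD[of "gsrc G" "dom a0" g h] by auto
    then show ?thesis using h sub by auto
  qed
  have "a \<in> bumps_at g" if a: "a \<in> U" for a
  proof -
    obtain c where c: "c \<in> U" "dominated m D S c a" using U(4)[OF a a] by blast
    show ?thesis using dominated_bumps_at[OF _ _ c(2) g_dom[OF c(1)]] c(1) a U(1) by blast
  qed
  moreover have "g \<in> arrows G" using g a0 U(1) S_sub_A dom_arrows by blast
  ultimately show thesis using that by blast
qed

text \<open>The space of arrows need not be Hausdorff. Arrows that cannot be separated have equal sources,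
  as the units are separated, and they lie in a common bisection.\<close>

lemma neighbourhoods_eq:
  assumes "g \<in> arrows G" "h \<in> arrows G" "\<And>U. openin T U \<Longrightarrow> g \<in> U \<Longrightarrow> h \<in> U"
  shows "g = h"
proof -
  have src: "gsrc G g = gsrc G h"
  proof (rule ccontr)
    assume "gsrc G g \<noteq> gsrc G h"
    moreover have "gsrc G g \<in> topspace (subtopology T (gunits G))"
      "gsrc G h \<in> topspace (subtopology T (gunits G))"
      using assms src_in_units src_closed topspace_T by auto
    ultimately obtain V W where VW: "openin (subtopology T (gunits G)) V"
      "openin (subtopology T (gunits G)) W" "gsrc G g \<in> V" "gsrc G h \<in> W" "disjnt V W"
      using Hausdorff_units unfolding Hausdorff_space_def by metis
    have "openin T {x \<in> arrows G. gsrc G x \<in> V}"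
      using open_src_rng_preimage(1)[OF open_arrows VW(1)] .
    then have "gsrc G h \<in> V" using assms VW by blast
    then show False using VW by (auto simp: disjnt_def)
  qed
  obtain a where a: "a \<in> S" "g \<in> dom a" using basic[OF open_arrows assms(1)] by metis
  have "h \<in> dom a" using assms(3) a S_sub_A open_dom by auto
  moreover have "inj_on (gsrc G) (dom a)" using a by (simp add: S_part_def bisection_iff)
  ultimately show ?thesis using src a by (auto dest: inj_onD)
qed

lemma bumps_at_subset_eq:
  assumes "g \<in> arrows G" "h \<in> arrows G" "bumps_at g \<subseteq> bumps_at h"
  shows "g = h"
proof (rule neighbourhoods_eq[OF assms(1,2)])
  fix U assume "openin T U" "g \<in> U"
  then obtain a where "a \<in> bumps_at g" "dom a \<subseteq> U" using bump by metis
  then show "h \<in> U" using assms(3) bumps_at_dom by blast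
qed

lemma bumps_at_mult:
  assumes "g \<in> arrows G" "h \<in> arrows G" "gsrc G g = grng G h" "a \<in> bumps_at g" "b \<in> bumps_at h"
  shows "m a b \<in> bumps_at (gmult G g h)"
proof -
  let ?I = "\<lambda>a. T interior_of level invertibles a"
  have ab: "a \<in> S" "b \<in> S" "a \<in> A" "b \<in> A" using assms bumps_at_S S_sub_A by auto
  have "set_gmult G (?I a) (?I b) \<subseteq> level invertibles (m a b)"
  proof
    fix k assume "k \<in> set_gmult G (?I a) (?I b)"
    then obtain x y where xy: "x \<in> ?I a" "y \<in> ?I b" "gsrc G x = grng G y" "k = gmult G x y"
      by (auto simp: set_gmult_def)
    have lev: "x \<in> dom a" "the (a x) \<in> invertibles" "y \<in> dom b" "the (b y) \<in> invertibles"
      using xy interior_of_subset[of T "level invertibles a"]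
        interior_of_subset[of T "level invertibles b"] by (auto simp: level_def)
    obtain x' y' where inv: "is_inverse (the (a x)) x'" "is_inverse (the (b y)) y'"
      using lev by (auto simp: invertibles_def)
    have "is_inverse (the (a x) * the (b y)) (y' * x')"
    proof (rule one_sided_inverse)
      have "the (a x) * the (b y) * (y' * x') = the (a x) * ((the (b y) * y') * x')"
        by (simp add: mult.assoc)
      then show "the (a x) * the (b y) * (y' * x') = 1" using inv by (simp add: is_inverse_def)
    qed
    then have "the (m a b k) \<in> invertibles"
      using value_mult[OF ab(3,4) _ lev(1,3) xy(3)] ab xy(4) by (auto simp: invertibles_def)
    moreover have "k \<in> dom (m a b)"
      using dom_mult[OF ab(3,4)] ab lev xy set_gmultI by simp
    ultimately show "k \<in> level invertibles (m a b)" by (simp add: level_def)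
  qed
  then have "set_gmult G (?I a) (?I b) \<subseteq> ?I (m a b)"
    by (intro interior_of_maximal open_set_gmult openin_interior_of)
  moreover have "gmult G g h \<in> set_gmult G (?I a) (?I b)"
    using assms by (intro set_gmultI) (auto simp: bumps_at_def)
  ultimately show ?thesis using S_mult ab by (auto simp: bumps_at_def)
qed

text \<open>If \<open>s(g) \<noteq> r(h)\<close> then bumps at \<open>g\<close> and \<open>h\<close> with small domains have an empty product,
  which is a bump at no arrow. Otherwise the domains of the products shrink to \<open>gh\<close>.\<close>

lemma bumps_at_mult_iff:
  assumes "g \<in> arrows G" "h \<in> arrows G" "k \<in> arrows G"
  shows "(\<forall>a\<in>bumps_at g. \<forall>b\<in>bumps_at h. m a b \<in> bumps_at k) \<longleftrightarrow>
    gsrc G g = grng G h \<and> k = gmult G g h"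
proof
  assume *: "\<forall>a\<in>bumps_at g. \<forall>b\<in>bumps_at h. m a b \<in> bumps_at k"
  have k: "k \<in> set_gmult G (dom a) (dom b)" if "a \<in> bumps_at g" "b \<in> bumps_at h" for a b
  proof -
    have "a \<in> S" "a \<in> A" "b \<in> A" using that bumps_at_S S_sub_A by auto
    moreover have "k \<in> dom (m a b)" using * that bumps_at_dom by blast
    ultimately show ?thesis using dom_mult[of a b] by simp
  qed
  have comp: "gsrc G g = grng G h"
  proof (rule ccontr)
    assume "gsrc G g \<noteq> grng G h"
    moreover have "gsrc G g \<in> topspace (subtopology T (gunits G))"
      "grng G h \<in> topspace (subtopology T (gunits G))"
      using assms src_in_units src_closed rng_in_units rng_closed topspace_T by auto
    ultimately obtain V W where VW: "openin (subtopology T (gunits G)) V"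
      "openin (subtopology T (gunits G)) W" "gsrc G g \<in> V" "grng G h \<in> W" "disjnt V W"
      using Hausdorff_units unfolding Hausdorff_space_def by metis
    have op: "openin T {x \<in> arrows G. gsrc G x \<in> V}" "openin T {x \<in> arrows G. grng G x \<in> W}"
      using open_src_rng_preimage[OF open_arrows] VW by auto
    have gh: "g \<in> {x \<in> arrows G. gsrc G x \<in> V}" "h \<in> {x \<in> arrows G. grng G x \<in> W}"
      using assms VW by auto
    obtain a where a: "a \<in> bumps_at g" "dom a \<subseteq> {x \<in> arrows G. gsrc G x \<in> V}"
      using bump[OF op(1) gh(1)] .
    obtain b where b: "b \<in> bumps_at h" "dom b \<subseteq> {x \<in> arrows G. grng G x \<in> W}"
      using bump[OF op(2) gh(2)] .
    obtain x y where "x \<in> dom a" "y \<in> dom b" "gsrc G x = grng G y"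
      using k[OF a(1) b(1)] by (auto simp: set_gmult_def)
    then have "gsrc G x \<in> V \<inter> W" using a(2) b(2) by auto
    then show False using VW(5) unfolding disjnt_def by blast
  qed
  have "gmult G g h = k"
  proof (rule neighbourhoods_eq)
    show "gmult G g h \<in> arrows G" using mult_closed assms comp by auto
    fix U assume U: "openin T U" "gmult G g h \<in> U"
    obtain V W where VW: "openin T V" "g \<in> V" "openin T W" "h \<in> W"
      "\<And>x y. x \<in> V \<Longrightarrow> y \<in> W \<Longrightarrow> gsrc G x = grng G y \<Longrightarrow> gmult G x y \<in> U"
      using mult_neighbourhoods[OF U(1) assms(1,2) comp U(2)] by metis
    obtain a where a: "a \<in> bumps_at g" "dom a \<subseteq> V" using bump[OF VW(1,2)] by metis
    obtain b where b: "b \<in> bumps_at h" "dom b \<subseteq> W" using bump[OF VW(3,4)] by metis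
    obtain x y where xy: "x \<in> dom a" "y \<in> dom b" "gsrc G x = grng G y" "k = gmult G x y"
      using k[OF a(1) b(1)] by (auto simp: set_gmult_def)
    then show "k \<in> U" using VW(5)[of x y] a(2) b(2) by blast
  qed (use assms in auto)
  then show "gsrc G g = grng G h \<and> k = gmult G g h" using comp by simp
qed (use bumps_at_mult assms in auto)

text \<open>The sets of all arrows at which a given element is a bump form a basis of the topology.\<close>

lemma openin_iff_bumps:
  "openin T U \<longleftrightarrow>
    U \<subseteq> arrows G \<and> (\<forall>g\<in>U. \<exists>a\<in>bumps_at g. \<forall>h\<in>arrows G. a \<in> bumps_at h \<longrightarrow> h \<in> U)"
proof (intro iffI conjI ballI)
  assume U: "openin T U"
  then show "U \<subseteq> arrows G" using openin_subset topspace_T by metis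
  fix g assume "g \<in> U"
  then obtain a where "a \<in> bumps_at g" "dom a \<subseteq> U" using bump[OF U] by metis
  then show "\<exists>a\<in>bumps_at g. \<forall>h\<in>arrows G. a \<in> bumps_at h \<longrightarrow> h \<in> U" using bumps_at_dom by blast
next
  assume *: "U \<subseteq> arrows G \<and> (\<forall>g\<in>U. \<exists>a\<in>bumps_at g. \<forall>h\<in>arrows G. a \<in> bumps_at h \<longrightarrow> h \<in> U)"
  show "openin T U"
  proof (subst openin_subopen, intro ballI)
    fix g assume g: "g \<in> U"
    then obtain a where "a \<in> bumps_at g" "\<forall>h\<in>arrows G. a \<in> bumps_at h \<longrightarrow> h \<in> U" using * by blast
    then show "\<exists>V. openin T V \<and> g \<in> V \<and> V \<subseteq> U"
      using open_bumps[of a] g * by (intro exI[of _ "{h \<in> arrows G. a \<in> bumps_at h}"]) auto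
  qed
qed

end

section \<open>Transport along an isomorphism\<close>

lemma branches_transfer:
  assumes inj: "inj_on \<phi> A" and hom: "\<And>a b. a \<in> A \<Longrightarrow> b \<in> A \<Longrightarrow> \<phi> (m a b) = m' (\<phi> a) (\<phi> b)"
    and closed: "\<And>a b. a \<in> A \<Longrightarrow> b \<in> A \<Longrightarrow> m a b \<in> A"
    and D: "D \<subseteq> A" and z: "z \<in> A" and a: "a \<in> A"
  shows "branches m' (\<phi> z) (\<phi> ` D) (\<phi> a) \<longleftrightarrow> branches m z D a"
proof -
  have DA: "d \<in> A" if "d \<in> D" for d using that D by blast
  have eq: "\<phi> x = \<phi> z \<longleftrightarrow> x = z" if "x \<in> A" for x
    using inj that z by (simp add: inj_on_eq_iff)
  have inner: "(m' (\<phi> e) (\<phi> e') \<noteq> \<phi> z \<longrightarrow> m' (\<phi> d) (m' (\<phi> a) (m' (\<phi> e) (\<phi> e'))) \<noteq> \<phi> z \<and>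
      m' (\<phi> d') (m' (\<phi> a) (m' (\<phi> e) (\<phi> e'))) \<noteq> \<phi> z) \<longleftrightarrow>
    (m e e' \<noteq> z \<longrightarrow> m d (m a (m e e')) \<noteq> z \<and> m d' (m a (m e e')) \<noteq> z)"
    if "d \<in> D" "d' \<in> D" "e \<in> D" "e' \<in> D" for d d' e e'
    using DA[OF that(1)] DA[OF that(2)] DA[OF that(3)] DA[OF that(4)] a
    by (simp only: hom[symmetric] closed eq)
  have outer: "m' (\<phi> d) (\<phi> d') = \<phi> z \<longleftrightarrow> m d d' = z" if "d \<in> D" "d' \<in> D" for d d'
    using DA[OF that(1)] DA[OF that(2)] by (simp only: hom[symmetric] closed eq)
  have ne: "\<phi> e \<noteq> \<phi> z \<longleftrightarrow> e \<noteq> z" if "e \<in> D" for e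
    using eq DA[OF that] by simp
  show ?thesis
    unfolding branches_def bex_simps(7) ball_simps(9)
    by (intro bex_cong ball_cong conj_cong refl inner outer ne)
qed

locale bumpy_isomorphism =
  src: bumpy_semigroup G T A m + tgt: bumpy_semigroup G' T' A' m'
  for G :: "'g groupoid_struct" and T
    and A :: "('g \<rightharpoonup> 'y::one_cancellative) set" and m
    and G' :: "'h groupoid_struct" and T'
    and A' :: "('h \<rightharpoonup> 'z::one_cancellative) set" and m' +
  fixes \<phi> :: "('g \<rightharpoonup> 'y) \<Rightarrow> ('h \<rightharpoonup> 'z)"
  assumes bij: "bij_betw \<phi> src.S tgt.S"
    and hom: "a \<in> src.S \<Longrightarrow> b \<in> src.S \<Longrightarrow> \<phi> (m a b) = m' (\<phi> a) (\<phi> b)"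
    and diagonal: "\<phi> ` src.D = tgt.D"
    and empty: "\<phi> Map.empty = Map.empty"
begin

lemma inv_\<phi>: "a \<in> src.S \<Longrightarrow> inv_into src.S \<phi> (\<phi> a) = a"
  using bij by (simp add: bij_betw_def)

lemma \<phi>_inv: "b \<in> tgt.S \<Longrightarrow> \<phi> (inv_into src.S \<phi> b) = b"
  using bij by (simp add: bij_betw_def f_inv_into_f)

lemma inverse: "bumpy_isomorphism G' T' A' m' G T A m (inv_into src.S \<phi>)"
proof (intro bumpy_isomorphism.intro bumpy_isomorphism_axioms.intro)
  show "bij_betw (inv_into src.S \<phi>) tgt.S src.S" using bij by (rule bij_betw_inv_into)
  then have mem: "inv_into src.S \<phi> b \<in> src.S" if "b \<in> tgt.S" for b
    using that by (rule bij_betwE[THEN bspec])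
  show "inv_into src.S \<phi> (m' a b) = m (inv_into src.S \<phi> a) (inv_into src.S \<phi> b)"
    if "a \<in> tgt.S" "b \<in> tgt.S" for a b
  proof -
    have "m' a b = \<phi> (m (inv_into src.S \<phi> a) (inv_into src.S \<phi> b))"
      using that mem by (simp add: hom \<phi>_inv)
    then show ?thesis using that mem by (simp add: inv_\<phi> src.S_mult)
  qed
  show "inv_into src.S \<phi> ` tgt.D = src.D"
    unfolding diagonal[symmetric] image_image
    using inv_\<phi> src.D_sub_S by (force simp: subset_iff)
  show "inv_into src.S \<phi> Map.empty = Map.empty"
    using inv_\<phi>[OF src.empty_S] empty by simp
qed (rule src.bumpy_semigroup_axioms tgt.bumpy_semigroup_axioms)+

lemma dominated_image:
  assumes "a \<in> src.S" "b \<in> src.S" "dominated m src.D src.S a b"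
  shows "dominated m' tgt.D tgt.S (\<phi> a) (\<phi> b)"
proof -
  obtain s where s: "s \<in> src.S" "m s b \<in> src.D" "m a s \<in> src.D" "m a (m s b) = a"
    using assms(3) by (auto simp: dominated_def)
  have "\<phi> s \<in> tgt.S" using s bij by (auto simp: bij_betw_def)
  moreover have "m' (\<phi> s) (\<phi> b) \<in> tgt.D" "m' (\<phi> a) (\<phi> s) \<in> tgt.D"
    using s assms hom[of s b] hom[of a s] diagonal by (metis imageI)+
  moreover have "m' (\<phi> a) (m' (\<phi> s) (\<phi> b)) = \<phi> a"
    using s assms hom[of s b] hom[of a "m s b"] src.S_mult by metis
  ultimately show ?thesis by (auto simp: dominated_def)
qed

lemma filter_image:
  assumes "domination_filter m Map.empty src.D src.S U"
  shows "domination_filter m' Map.empty tgt.D tgt.S (\<phi> ` U)"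
proof -
  have U: "U \<subseteq> src.S" "U \<noteq> {}" "Map.empty \<notin> U"
    "\<And>a b. a \<in> U \<Longrightarrow> b \<in> U \<Longrightarrow>
      \<exists>c\<in>U. dominated m src.D src.S c a \<and> dominated m src.D src.S c b"
    using assms by (auto simp: domination_filter_def)
  have "\<phi> a \<noteq> Map.empty" if "a \<in> U" for a
  proof
    assume "\<phi> a = Map.empty"
    moreover have "a \<in> src.S" using that U(1) by blast
    ultimately have "a = Map.empty" using inv_\<phi>[of a] inv_\<phi>[OF src.empty_S] empty by metis
    then show False using that U(3) by simp
  qed
  moreover have "\<exists>c\<in>U. dominated m' tgt.D tgt.S (\<phi> c) (\<phi> a) \<and> dominated m' tgt.D tgt.S (\<phi> c) (\<phi> b)"
    if "a \<in> U" "b \<in> U" for a b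
  proof -
    obtain c where "c \<in> U" "dominated m src.D src.S c a" "dominated m src.D src.S c b"
      using U(4)[OF \<open>a \<in> U\<close> \<open>b \<in> U\<close>] by blast
    moreover from this have "c \<in> src.S" "a \<in> src.S" "b \<in> src.S" using that U(1) by auto
    ultimately show ?thesis using dominated_image by blast
  qed
  moreover have "\<phi> ` U \<subseteq> tgt.S" using U(1) bij by (auto simp: bij_betw_def)
  ultimately show ?thesis
    using U(2) unfolding domination_filter_def by (simp add: image_iff) metis
qed

text \<open>The image of the filter at \<open>g\<close> lies in the filter at some \<open>g'\<close>, whose preimage in turn lies in
  the filter at some \<open>h\<close>; as points are determined by inclusions between their filters,
  \<open>h = g\<close> and all these inclusions are equalities.\<close>

lemma bumps_at_image:
  assumes g: "g \<in> arrows G"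
  shows "\<exists>g'\<in>arrows G'. tgt.bumps_at g' = \<phi> ` src.bumps_at g"
proof -
  obtain g' where g': "g' \<in> arrows G'" "\<phi> ` src.bumps_at g \<subseteq> tgt.bumps_at g'"
    using tgt.filter_subset_bumps_at[OF filter_image[OF src.bumps_at_filter[OF g]]] .
  interpret inv: bumpy_isomorphism G' T' A' m' G T A m "inv_into src.S \<phi>" by (rule inverse)
  obtain h where h: "h \<in> arrows G" "inv_into src.S \<phi> ` tgt.bumps_at g' \<subseteq> src.bumps_at h"
    using src.filter_subset_bumps_at[OF inv.filter_image[OF tgt.bumps_at_filter[OF g'(1)]]] .
  have "src.bumps_at g \<subseteq> src.bumps_at h"
  proof
    fix a assume a: "a \<in> src.bumps_at g"
    then have "inv_into src.S \<phi> (\<phi> a) \<in> src.bumps_at h" using g' h by blast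
    then show "a \<in> src.bumps_at h" using inv_\<phi>[OF src.bumps_at_S[OF a]] by simp
  qed
  then have "g = h" using src.bumps_at_subset_eq g h by blast
  have "tgt.bumps_at g' \<subseteq> \<phi> ` src.bumps_at g"
  proof
    fix b assume b: "b \<in> tgt.bumps_at g'"
    then have "inv_into src.S \<phi> b \<in> src.bumps_at g" using h \<open>g = h\<close> by blast
    then show "b \<in> \<phi> ` src.bumps_at g" using \<phi>_inv[OF tgt.bumps_at_S[OF b]] by (metis imageI)
  qed
  then show ?thesis using g' by blast
qed

definition \<psi> :: "'g \<Rightarrow> 'h"
  where "\<psi> g = (SOME g'. g' \<in> arrows G' \<and> tgt.bumps_at g' = \<phi> ` src.bumps_at g)"

lemma \<psi>:
  assumes "g \<in> arrows G"
  shows "\<psi> g \<in> arrows G'" and "tgt.bumps_at (\<psi> g) = \<phi> ` src.bumps_at g"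
proof -
  have "\<exists>g'. g' \<in> arrows G' \<and> tgt.bumps_at g' = \<phi> ` src.bumps_at g"
    using bumps_at_image[OF assms] by blast
  from someI_ex[OF this] show "\<psi> g \<in> arrows G'" "tgt.bumps_at (\<psi> g) = \<phi> ` src.bumps_at g"
    unfolding \<psi>_def by simp_all
qed

lemma \<psi>_bumps: "g \<in> arrows G \<Longrightarrow> a \<in> src.S \<Longrightarrow> \<phi> a \<in> tgt.bumps_at (\<psi> g) \<longleftrightarrow> a \<in> src.bumps_at g"
  using \<psi>(2)[of g] inv_\<phi> src.bumps_at_S by (auto simp: image_iff) metis

lemma bij_\<psi>: "bij_betw \<psi> (arrows G) (arrows G')"
  unfolding bij_betw_def
proof
  show "inj_on \<psi> (arrows G)"
  proof (rule inj_onI)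
    fix g h assume gh: "g \<in> arrows G" "h \<in> arrows G" "\<psi> g = \<psi> h"
    have "src.bumps_at g \<subseteq> src.bumps_at h"
      using \<psi>_bumps[OF gh(1)] \<psi>_bumps[OF gh(2)] gh(3) src.bumps_at_S by auto
    then show "g = h" using src.bumps_at_subset_eq gh by blast
  qed
  show "\<psi> ` arrows G = arrows G'"
  proof
    show "\<psi> ` arrows G \<subseteq> arrows G'" using \<psi>(1) by blast
    show "arrows G' \<subseteq> \<psi> ` arrows G"
    proof
      fix g' assume g': "g' \<in> arrows G'"
      obtain g where g: "g \<in> arrows G" "src.bumps_at g = inv_into src.S \<phi> ` tgt.bumps_at g'"
        using bumpy_isomorphism.bumps_at_image[OF inverse g'] by blast
      have "\<phi> ` src.bumps_at g = tgt.bumps_at g'"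
        unfolding g(2) image_image using \<phi>_inv tgt.bumps_at_S by force
      then have "tgt.bumps_at (\<psi> g) = tgt.bumps_at g'" using \<psi>(2)[OF g(1)] by simp
      then have "\<psi> g = g'" using tgt.bumps_at_subset_eq[OF \<psi>(1)[OF g(1)] g'] by simp
      then show "g' \<in> \<psi> ` arrows G" using g by blast
    qed
  qed
qed

text \<open>Both sides say that the products of bumps at \<open>g\<close> and \<open>h\<close> are bumps at \<open>k\<close>.\<close>

lemma \<psi>_mult_iff:
  assumes "g \<in> arrows G" "h \<in> arrows G" "k \<in> arrows G"
  shows "gsrc G' (\<psi> g) = grng G' (\<psi> h) \<and> \<psi> k = gmult G' (\<psi> g) (\<psi> h) \<longleftrightarrow>
    gsrc G g = grng G h \<and> k = gmult G g h"
proof -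
  have "(\<forall>a\<in>src.bumps_at g. \<forall>b\<in>src.bumps_at h. m' (\<phi> a) (\<phi> b) \<in> tgt.bumps_at (\<psi> k)) \<longleftrightarrow>
      (\<forall>a\<in>src.bumps_at g. \<forall>b\<in>src.bumps_at h. m a b \<in> src.bumps_at k)"
  proof (intro ball_cong refl)
    fix a b assume "a \<in> src.bumps_at g" "b \<in> src.bumps_at h"
    then have "a \<in> src.S" "b \<in> src.S" using src.bumps_at_S by auto
    then show "m' (\<phi> a) (\<phi> b) \<in> tgt.bumps_at (\<psi> k) \<longleftrightarrow> m a b \<in> src.bumps_at k"
      using hom[of a b] \<psi>_bumps[OF assms(3) src.S_mult[of a b]] by simp
  qed
  then show ?thesis
    using tgt.bumps_at_mult_iff[OF assms[THEN \<psi>(1)]] src.bumps_at_mult_iff[OF assms]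
      \<psi>(2)[OF assms(1)] \<psi>(2)[OF assms(2)] by simp
qed

lemma groupoid_isomorphism_\<psi>: "groupoid_isomorphism G G' \<psi>"
  unfolding groupoid_isomorphism_def
proof (intro conjI ballI impI)
  fix g h assume gh: "g \<in> arrows G" "h \<in> arrows G"
  show mult: "\<psi> (gmult G g h) = gmult G' (\<psi> g) (\<psi> h)" if "gsrc G g = grng G h"
    using \<psi>_mult_iff[OF gh src.mult_closed[OF gh that]] that by simp
  show "gsrc G g = grng G h \<longleftrightarrow> gsrc G' (\<psi> g) = grng G' (\<psi> h)"
  proof
    show "gsrc G' (\<psi> g) = grng G' (\<psi> h)" if "gsrc G g = grng G h"
      using \<psi>_mult_iff[OF gh src.mult_closed[OF gh that]] that by simp
    assume c: "gsrc G' (\<psi> g) = grng G' (\<psi> h)"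
    have "gmult G' (\<psi> g) (\<psi> h) \<in> \<psi> ` arrows G"
      using bij_\<psi> tgt.mult_closed[OF \<psi>(1)[OF gh(1)] \<psi>(1)[OF gh(2)] c] by (simp add: bij_betw_def)
    then obtain k where "k \<in> arrows G" "\<psi> k = gmult G' (\<psi> g) (\<psi> h)" by force
    then show "gsrc G g = grng G h" using \<psi>_mult_iff[OF gh] c by blast
  qed
qed (rule bij_\<psi>)

lemma openin_\<psi>_image_iff:
  assumes U: "U \<subseteq> arrows G"
  shows "openin T' (\<psi> ` U) \<longleftrightarrow> openin T U"
proof -
  have inj: "\<psi> h \<in> \<psi> ` U \<longleftrightarrow> h \<in> U" if "h \<in> arrows G" for h
    using that U bij_\<psi> by (meson bij_betw_imp_inj_on inj_on_image_mem_iff)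
  have img: "arrows G' = \<psi> ` arrows G" using bij_\<psi> by (simp add: bij_betw_def)
  have ball: "(\<forall>h'\<in>arrows G'. \<phi> a \<in> tgt.bumps_at h' \<longrightarrow> h' \<in> \<psi> ` U) \<longleftrightarrow>
      (\<forall>h\<in>arrows G. a \<in> src.bumps_at h \<longrightarrow> h \<in> U)" if "a \<in> src.S" for a
    unfolding img ball_simps(9) using inj \<psi>_bumps[OF _ that] by simp
  have bex: "(\<exists>b\<in>tgt.bumps_at (\<psi> g). \<forall>h'\<in>arrows G'. b \<in> tgt.bumps_at h' \<longrightarrow> h' \<in> \<psi> ` U) \<longleftrightarrow>
      (\<exists>a\<in>src.bumps_at g. \<forall>h\<in>arrows G. a \<in> src.bumps_at h \<longrightarrow> h \<in> U)" if "g \<in> U" for g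
  proof -
    have "g \<in> arrows G" using that U by blast
    then show ?thesis
      unfolding \<psi>(2)[OF \<open>g \<in> arrows G\<close>] bex_simps(7)
      by (intro bex_cong refl ball src.bumps_at_S)
  qed
  have "\<psi> ` U \<subseteq> arrows G'" using U img by blast
  then show ?thesis
    unfolding tgt.openin_iff_bumps src.openin_iff_bumps ball_simps(9)
    using U bex by simp
qed

lemma homeomorphic_map_\<psi>: "homeomorphic_map T T' \<psi>"
  unfolding homeomorphic_map_def quotient_map_def src.topspace_T tgt.topspace_T
proof (intro conjI allI impI)
  show "\<psi> ` arrows G = arrows G'" "inj_on \<psi> (arrows G)" using bij_\<psi> by (auto simp: bij_betw_def)
  fix V assume V: "V \<subseteq> arrows G'"
  have "\<psi> ` {g \<in> arrows G. \<psi> g \<in> V} = V"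
    using V bij_\<psi> by (auto simp: bij_betw_def)
  then show "openin T {g \<in> arrows G. \<psi> g \<in> V} \<longleftrightarrow> openin T' V"
    using openin_\<psi>_image_iff[of "{g \<in> arrows G. \<psi> g \<in> V}"] by simp
qed

end

theorem corollary6p7:
  fixes G :: "'g groupoid_struct" and T :: "'g topology"
    and A :: "('g \<rightharpoonup> 'y::one_cancellative) set"
    and m :: "('g \<rightharpoonup> 'y) \<Rightarrow> ('g \<rightharpoonup> 'y) \<Rightarrow> ('g \<rightharpoonup> 'y)"
    and G' :: "'h groupoid_struct" and T' :: "'h topology"
    and A' :: "('h \<rightharpoonup> 'z::one_cancellative) set"
    and m' :: "('h \<rightharpoonup> 'z) \<Rightarrow> ('h \<rightharpoonup> 'z) \<Rightarrow> ('h \<rightharpoonup> 'z)"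
  assumes "groupoid G" and "topspace T = arrows G"
    and "groupoid G'" and "topspace T' = arrows G'"
    and "Hausdorff_space (subtopology T (gunits G))"
    and "Hausdorff_space (subtopology T' (gunits G'))"
    and "pfun_semigroup G T A m"
    and "pfun_semigroup G' T' A' m'"
    and "exhaustive G (D_part G A)"
    and "exhaustive G' (D_part G' A')"
    and "S_part G A = N_part G A" and "Z_bumpy G T m (Z_part G A) (S_part G A)"
    and "S_part G' A' = N_part G' A'" and "Z_bumpy G' T' m' (Z_part G' A') (S_part G' A')"
    and "diagonally_isomorphic G A m G' A' m'"
  shows "etale G T \<and> etale G' T' \<and>
    (\<exists>\<psi>. groupoid_isomorphism G G' \<psi> \<and> homeomorphic_map T T' \<psi>)"
proof -
  interpret src: bumpy_semigroup G T A m
    using assms by (simp add: bumpy_semigroup_def bumpy_semigroup_axioms_def)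
  interpret tgt: bumpy_semigroup G' T' A' m'
    using assms by (simp add: bumpy_semigroup_def bumpy_semigroup_axioms_def)
  obtain \<phi> where \<phi>: "bij_betw \<phi> A A'" "\<And>a b. a \<in> A \<Longrightarrow> b \<in> A \<Longrightarrow> \<phi> (m a b) = m' (\<phi> a) (\<phi> b)"
    "\<phi> ` D_part G A = D_part G' A'"
    using assms(15) by (auto simp: diagonally_isomorphic_def)
  have inj: "inj_on \<phi> A" and img: "A' = \<phi> ` A" using \<phi>(1) by (auto simp: bij_betw_def)
  \<comment> \<open>The empty function is the zero of each semigroup, hence corresponds to itself.\<close>
  have emptyA: "Map.empty \<in> A" using src.empty_S src.S_sub_A by blast
  have "Map.empty \<in> \<phi> ` A" using tgt.empty_S tgt.S_sub_A img by blast
  then obtain o' where o': "o' \<in> A" "\<phi> o' = Map.empty" by (metis imageE)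
  have "\<phi> Map.empty = m' (\<phi> Map.empty) (\<phi> o')"
    using \<phi>(2)[OF emptyA o'(1)] src.mult_empty(1)[OF o'(1)] by simp
  then have empty: "\<phi> Map.empty = Map.empty"
    using tgt.mult_empty(2)[of "\<phi> Map.empty"] o'(2) emptyA img by simp
  have DA: "D_part G A \<subseteq> A" using src.D_sub_S src.S_sub_A by blast
  have branches: "branches m' Map.empty (D_part G' A') (\<phi> a) \<longleftrightarrow> branches m Map.empty (D_part G A) a"
    "branches (\<lambda>x y. m' y x) Map.empty (D_part G' A') (\<phi> a) \<longleftrightarrow>
      branches (\<lambda>x y. m y x) Map.empty (D_part G A) a"
    if "a \<in> A" for a
    using branches_transfer[of \<phi> A m m' "D_part G A" Map.empty a]
      branches_transfer[of \<phi> A "\<lambda>x y. m y x" "\<lambda>x y. m' y x" "D_part G A" Map.empty a]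
      inj \<phi>(2) src.mult_A DA emptyA that unfolding empty \<phi>(3) by simp_all
  have "\<phi> a \<in> S_part G' A' \<longleftrightarrow> a \<in> S_part G A" if "a \<in> A" for a
    unfolding assms(11,13) src.N_part_eq tgt.N_part_eq
    using branches[OF that] that bij_betwE[OF \<phi>(1)] by simp
  then have "S_part G' A' = \<phi> ` S_part G A"
    using img src.S_sub_A tgt.S_sub_A by blast
  then have bij: "bij_betw \<phi> (S_part G A) (S_part G' A')"
    using inj src.S_sub_A by (auto simp: bij_betw_def intro: inj_on_subset)
  have homS: "\<phi> (m a b) = m' (\<phi> a) (\<phi> b)" if "a \<in> S_part G A" "b \<in> S_part G A" for a b
    using \<phi>(2) that src.S_sub_A by blast
  interpret bumpy_isomorphism G T A m G' T' A' m' \<phi>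
    by unfold_locales (fact bij, fact homS, fact \<phi>(3), fact empty)
  show ?thesis
    using src.etale tgt.etale groupoid_isomorphism_\<psi> homeomorphic_map_\<psi> by blast
qed

end
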